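(* Let $\eta^{12}(2z) = \sum_{n=1}^\infty \gamma(n)q^n$ be the unique newform in $S_6(\Gamma_0(4))$. Then for every odd prime $p$, $$\gamma(p) \equiv \sum_{\substack{k_1,k_2,k_3,k_4=0\\ k_1+k_2=k_3+k_4}}^{\frac{p-1}{2}}\ \prod_{i=1}^4\binom{\frac{p-1}{2}}{k_i}\binom{\frac{p-1}{2}+k_i}{k_i} \pmod{p^2}.$$
   Context: $\eta(z) = q^{1/24}\prod_{n\ge1}(1-q^n)$ is the Dedekind eta function, $q = e^{2\pi i z}$. The sum runs over integers $0 \le k_i \le \frac{p-1}{2}$ with $k_1+k_2 = k_3+k_4$. *)

theory Defs
  imports "HOL-Computational_Algebra.Polynomial" "HOL-Number_Theory.Cong"
begin

text \<open>eta(2z)^12 = q^{(12*2)/24} prod_{m>=1} (1 - q^{2m})^12 = q * prod_{m>=1} (1 - q^{2m})^12.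
  Hence the coefficient gamma(n) of q^n (n >= 1) is the coefficient of X^(n-1) in
  prod_{m>=1} (1 - X^{2m})^12; factors with m > n do not affect this coefficient,
  so the finite product over m = 1..n gives the exact value.\<close>

definition eta12_coeff :: "nat \<Rightarrow> int" where
  "eta12_coeff n = (if n = 0 then 0
     else coeff (\<Prod>m\<in>{1..n}. (1 - monom (1::int) (2*m)) ^ 12) (n - 1))"

definition binom_term :: "nat \<Rightarrow> nat \<Rightarrow> int" where
  "binom_term h k = int ((h choose k) * ((h + k) choose k))"

end

theory Submission
  imports Defs "HOL-Computational_Algebra.Formal_Power_Series"
begin

text \<open>
  Let \<open>t = (\<theta>\<^sub>3\<^sup>4 - \<theta>\<^sub>4\<^sup>4) / (16 \<theta>\<^sub>3\<^sup>4)\<close>, a power series in \<open>q\<close>, and let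
  \<open>F(x) = \<Sum> binom(2k, k)\<^sup>2 x\<^sup>k\<close>. Jacobi's relations \<open>F(t) = \<theta>\<^sub>3\<^sup>2\<close> and
  \<open>q dt/dq = \<theta>\<^sub>4\<^sup>4 t\<close> turn \<open>\<eta>(2z)\<^sup>1\<^sup>2 dq/q\<close> into \<open>F(t)\<^sup>4 dt\<close>. They are obtained from the
  doubling formulas \<open>q \<mapsto> q\<^sup>2\<close> of the theta series: both sides of each relation satisfy the same
  functional equation, which has only one solution with a given constant term. So \<open>\<gamma>(p)\<close> is the
  residue of \<open>F(t)\<^sup>4 q\<^sup>-\<^sup>p dt\<close>.

  Let \<open>p = 2h + 1\<close> and \<open>B = binom(2h, h)\<close>. Modulo \<open>p\<^sup>2\<close> and \<open>x\<^sup>p\<close>, the series \<open>F\<close> is congruent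
  to the Legendre polynomial \<open>P(x) = \<Sum> binom(h, k) binom(h + k, k) (-16x)\<^sup>k\<close>. Its reversal
  \<open>Y(x) = (-16x)\<^sup>h P(1/(256x))\<close> is congruent to \<open>B F\<close> modulo \<open>p\<close>, and modulo \<open>p\<^sup>2\<close> the series
  \<open>x\<^sup>-\<^sup>p\<^sup>/\<^sup>2 Y\<close> satisfies the differential equation of \<open>F\<close>. The Wronskian of the two therefore gives
  \<open>Y(t)\<^sup>2 \<equiv> B\<^sup>2 F(t)\<^sup>2 (t/q)\<^sup>p\<close> modulo \<open>p\<^sup>2\<close> and \<open>q\<^sup>p\<close>. Hence \<open>B\<^sup>2 \<gamma>(p)\<close> is congruent to the
  residue of \<open>F(t)\<^sup>2 Y(t)\<^sup>2 t\<^sup>-\<^sup>p dt\<close>, and thus to the coefficient of \<open>x\<^sup>2\<^sup>h\<close> in \<open>P\<^sup>2 Y\<^sup>2\<close>. The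
  reversal makes this coefficient \<open>256\<^sup>h\<close> times the sum over \<open>k\<^sub>1 + k\<^sub>2 = k\<^sub>3 + k\<^sub>4\<close>, and
  \<open>B\<^sup>2 \<equiv> 256\<^sup>h\<close> modulo \<open>p\<^sup>2\<close>.
\<close>

unbundle fps_syntax

section \<open>Dilation and the Euler derivation of power series\<close>

definition dilate :: "'a::comm_ring_1 fps \<Rightarrow> 'a fps" where
  "dilate f = f oo fps_X ^ 2"

lemma dilate_nth: "dilate f $ n = (if even n then f $ (n div 2) else 0)"
proof -
  have "dilate f $ n = (\<Sum>i=0..n. if n = 2 * i then f $ i else 0)"
    by (auto simp: dilate_def fps_compose_nth fps_X_power_nth simp flip: power_mult
        intro!: sum.cong)
  also have "\<dots> = (if even n then f $ (n div 2) else 0)"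
    by (auto elim!: evenE intro!: sum.neutral)
  finally show ?thesis .
qed

lemma dilate_nth_0 [simp]: "dilate f $ 0 = f $ 0"
  by (simp add: dilate_nth)

lemma dilate_diff [simp]: "dilate (f - g) = dilate f - dilate g"
  and dilate_numeral [simp]: "dilate (numeral k) = numeral k"
  and dilate_1 [simp]: "dilate 1 = 1"
  by (simp_all add: dilate_def fps_compose_sub_distrib)

lemma dilate_mult [simp]: "dilate (f * g) = dilate f * dilate g"
  and dilate_power [simp]: "dilate (f ^ n) = dilate f ^ n"
  and dilate_X [simp]: "dilate fps_X = (fps_X ^ 2 :: 'a fps)"
  for f g :: "'a::idom fps"
  by (simp_all add: dilate_def fps_compose_mult_distrib fps_compose_power)

lemma dilate_compose:
  fixes f g :: "'a::idom fps"
  assumes "g $ 0 = 0"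
  shows "dilate (f oo g) = f oo dilate g"
  unfolding dilate_def by (rule fps_compose_assoc [symmetric]) (use assms in auto)

lemma compose_power2:
  fixes f g :: "'a::idom fps"
  assumes "g $ 0 = 0"
  shows "f oo g ^ 2 = dilate f oo g"
proof -
  have "dilate f oo g = f oo (fps_X ^ 2 oo g)"
    unfolding dilate_def by (rule fps_compose_assoc [symmetric]) (use assms in auto)
  then show ?thesis
    using assms by (simp flip: fps_compose_power)
qed

lemma subdegree_dilate [simp]: "subdegree (dilate f) = 2 * subdegree (f :: 'a::idom fps)"
  by (simp add: dilate_def)

lemma dilate_eq_0_iff [simp]: "dilate f = 0 \<longleftrightarrow> f = (0 :: 'a::idom fps)"
  by (simp add: dilate_def fps_compose_eq_0_iff)

text \<open>If \<open>f - g\<close> vanished to order \<open>n > 0\<close> exactly, the two sides of the difference of the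
  equations would vanish to the orders \<open>n\<close> and \<open>2n\<close>, up to the common order of
  \<open>u\<close> and \<open>w\<close>.\<close>

lemma dilate_equation_unique:
  fixes f g u w :: "'a::{idom, ring_char_0} fps"
  assumes f: "f ^ m * u = w * dilate f" and g: "g ^ m * u = w * dilate g"
    and nth_0: "f $ 0 = g $ 0" "g $ 0 \<noteq> 0" and "m > 0" and "u \<noteq> 0"
  shows "f = g"
proof (rule ccontr)
  assume "f \<noteq> g"
  define d where "d = f - g"
  define H where "H = (\<Sum>i<m. g ^ (m - Suc i) * f ^ i)"
  have "d \<noteq> 0" and "d $ 0 = 0"
    using \<open>f \<noteq> g\<close> nth_0 by (simp_all add: d_def)
  then have "subdegree d > 0"
    using subdegree_eq_0_iff by blast
  have "H $ 0 = (\<Sum>i<m. (g $ 0) ^ (m - Suc i + i))"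
    unfolding H_def fps_sum_nth power_add by (simp add: fps_power_zeroth nth_0)
  also have "\<dots> = of_nat m * (g $ 0) ^ (m - 1)"
    by simp
  finally have "H $ 0 \<noteq> 0"
    using nth_0 \<open>m > 0\<close> by simp
  then have "H \<noteq> 0" and "subdegree H = 0"
    by auto
  have "g \<noteq> 0" and "subdegree g = 0"
    using nth_0 by auto
  have "w \<noteq> 0"
    using g \<open>g \<noteq> 0\<close> \<open>u \<noteq> 0\<close> by auto
  have "subdegree u = subdegree w"
    using arg_cong [OF g, of subdegree] \<open>g \<noteq> 0\<close> \<open>subdegree g = 0\<close> \<open>u \<noteq> 0\<close> \<open>w \<noteq> 0\<close>
    by simp
  moreover have "d * H * u = w * dilate d"
    unfolding d_def H_def power_diff_sumr2 [symmetric]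
    using f g by (simp add: left_diff_distrib right_diff_distrib)
  then have "subdegree d + subdegree u = subdegree w + 2 * subdegree d"
    using \<open>d \<noteq> 0\<close> \<open>H \<noteq> 0\<close> \<open>u \<noteq> 0\<close> \<open>w \<noteq> 0\<close> \<open>subdegree H = 0\<close>
    by (metis add.right_neutral dilate_eq_0_iff mult_eq_0_iff subdegree_dilate subdegree_mult)
  ultimately have "subdegree d = 0"
    by simp
  with \<open>subdegree d > 0\<close> show False
    by simp
qed

abbreviation XD :: "'a::comm_ring_1 fps \<Rightarrow> 'a fps" where
  "XD \<equiv> fps_XD"

lemma XD_eq: "XD f = fps_X * fps_deriv f"
  by (simp add: fps_XD_def)

lemma XD_diff [simp]: "XD (f - g) = XD f - XD g"
  and XD_mult: "XD (f * g) = XD f * g + f * XD g"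
  and XD_numeral [simp]: "XD (numeral k) = 0"
  and XD_of_nat [simp]: "XD (of_nat n) = 0"
  and XD_1 [simp]: "XD 1 = 0"
  and XD_X [simp]: "XD fps_X = fps_X"
  by (simp_all add: XD_eq algebra_simps)

lemma XD_power: "XD (f ^ n) = of_nat n * f ^ (n - 1) * XD f"
  by (simp add: XD_eq fps_deriv_power fps_of_nat mult_ac)

lemma XD_square: "XD (f ^ 2) = 2 * f * XD f"
  by (simp add: XD_power)

lemma XD_dilate: "XD (dilate f) = 2 * dilate (XD f)"
  by (auto simp: fps_eq_iff dilate_nth numeral_fps_const elim!: evenE)

lemma XD_compose:
  fixes f g k :: "'a::idom fps"
  assumes "g $ 0 = 0" and "XD g = k * g"
  shows "XD (f oo g) = k * (XD f oo g)"
proof -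
  have "XD (f oo g) = (fps_deriv f oo g) * XD g"
    by (simp add: XD_eq fps_compose_deriv assms)
  also have "\<dots> = k * (g * (fps_deriv f oo g))" by (simp add: assms)
  also have "g * (fps_deriv f oo g) = XD f oo g"
    by (simp add: XD_eq fps_compose_mult_distrib assms)
  finally show ?thesis .
qed

lemma XD_inverse:
  fixes f :: "'a::field fps"
  assumes "f $ 0 \<noteq> 0"
  shows "XD (inverse f) = - XD f * inverse f ^ 2"
  using fps_inverse_deriv [OF assms] by (simp add: XD_eq algebra_simps)

lemma XD_wronskian: "XD (a * (f * XD g - g * XD f)) = f * XD (a * XD g) - g * XD (a * XD f)"
  by (simp add: XD_mult algebra_simps)

lemma XD_ode_unique:
  fixes f g a b :: "'a::{idom, ring_char_0} fps"
  assumes f: "XD (a * XD f) = b * f" and g: "XD (a * XD g) = b * g"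
    and "a $ 0 \<noteq> 0" "b $ 0 = 0" and "f $ 0 = g $ 0"
  shows "f = g"
proof (rule ccontr)
  assume "f \<noteq> g"
  define d where "d = f - g"
  define n where "n = subdegree d"
  have "d \<noteq> 0" and "d $ 0 = 0"
    using \<open>f \<noteq> g\<close> assms(5) by (simp_all add: d_def)
  then have "n \<noteq> 0"
    using subdegree_eq_0_iff by (auto simp: n_def)
  have small: "d $ i = 0" if "i < n" for i
    using that by (simp add: n_def nth_less_subdegree_zero)
  have "(a * XD d) $ n = (\<Sum>i=0..n. if i = 0 then a $ 0 * XD d $ n else 0)"
    unfolding fps_mult_nth by (intro sum.cong) (auto simp: small)
  moreover have "b $ i * d $ (n - i) = 0" if "i \<le> n" for i
    using that assms(4) small [of "n - i"] by (cases "i = 0") auto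
  then have "(b * d) $ n = 0"
    unfolding fps_mult_nth by (intro sum.neutral) simp
  moreover have "XD (a * XD d) = b * d"
    using f g by (simp add: d_def algebra_simps)
  then have "of_nat n * (a * XD d) $ n = (b * d) $ n"
    by (metis fps_XD_nth)
  ultimately have "d $ n = 0"
    using \<open>n \<noteq> 0\<close> assms(3) by simp
  then show False
    using \<open>d \<noteq> 0\<close> by (simp add: n_def)
qed

section \<open>Theta series\<close>

definition sq_reps :: "nat \<Rightarrow> int set" where
  "sq_reps n = {x. x ^ 2 = int n}"

definition two_sq_reps :: "nat \<Rightarrow> (int \<times> int) set" where
  "two_sq_reps n = {(x, y). x ^ 2 + y ^ 2 = int n}"

definition square_series :: "(int \<Rightarrow> 'a::comm_ring_1) \<Rightarrow> 'a fps" where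
  "square_series c = Abs_fps (\<lambda>n. \<Sum>x\<in>sq_reps n. c x)"

definition theta3 :: "rat fps" where
  "theta3 = square_series (\<lambda>x. 1)"

definition theta4 :: "rat fps" where
  "theta4 = square_series (\<lambda>x. (-1) powi x)"

lemma abs_le_square_int: "\<bar>x\<bar> \<le> (x :: int) ^ 2"
  using self_le_power [of "\<bar>x\<bar>" 2] by (cases "x = 0") auto

lemma sq_reps_subset: "sq_reps n \<subseteq> {- int n..int n}"
proof
  fix x assume "x \<in> sq_reps n"
  then show "x \<in> {- int n..int n}"
    using abs_le_square_int [of x] by (auto simp: sq_reps_def)
qed

lemma finite_sq_reps [simp]: "finite (sq_reps n)"
  by (rule finite_subset [OF sq_reps_subset]) simp

lemma two_sq_reps_eq: "two_sq_reps n = (\<Union>i\<in>{0..n}. sq_reps i \<times> sq_reps (n - i))"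
proof (intro equalityI subsetI)
  fix p assume "p \<in> two_sq_reps n"
  then obtain x y where p: "p = (x, y)" and "x ^ 2 + y ^ 2 = int n"
    by (auto simp: two_sq_reps_def)
  moreover from this have "x ^ 2 \<le> int n"
    using zero_le_power2 [of y] by linarith
  ultimately have "nat (x ^ 2) \<le> n" and "y ^ 2 = int (n - nat (x ^ 2))"
    by (auto simp: nat_le_iff of_nat_diff)
  then show "p \<in> (\<Union>i\<in>{0..n}. sq_reps i \<times> sq_reps (n - i))"
    by (auto simp: p sq_reps_def intro!: bexI [of _ "nat (x ^ 2)"])
qed (auto simp: two_sq_reps_def sq_reps_def of_nat_diff)

lemma square_series_mult_nth:
  "(square_series c * square_series d) $ n = (\<Sum>(x, y)\<in>two_sq_reps n. c x * d y)"
proof -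
  have "(square_series c * square_series d) $ n
      = (\<Sum>i=0..n. \<Sum>(x, y)\<in>sq_reps i \<times> sq_reps (n - i). c x * d y)"
    by (simp add: fps_mult_nth square_series_def sum_product sum.cartesian_product)
  also have "\<dots> = (\<Sum>(x, y)\<in>two_sq_reps n. c x * d y)"
    unfolding two_sq_reps_eq
    by (rule sum.UNION_disjoint [symmetric]) (auto, auto simp: sq_reps_def)
  finally show ?thesis .
qed

lemma even_two_sq_reps:
  assumes "(x, y) \<in> two_sq_reps n"
  shows "(even x \<longleftrightarrow> even y) \<longleftrightarrow> even n"
proof -
  have "even (x ^ 2 + y ^ 2) \<longleftrightarrow> even (int n)"
    using assms by (simp add: two_sq_reps_def)
  then show ?thesis by simp
qed

lemma bij_betw_two_sq_reps:
  "bij_betw (\<lambda>(u, v). (u + v, u - v)) (two_sq_reps n) (two_sq_reps (2 * n))"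
proof (rule bij_betwI')
  fix xy assume xy: "xy \<in> two_sq_reps (2 * n)"
  obtain x y where [simp]: "xy = (x, y)" by fastforce
  have "even (x + y)" "even (x - y)"
    using xy even_two_sq_reps [of x y "2 * n"] by auto
  then obtain u v where "x + y = 2 * u" "x - y = 2 * v"
    by (elim evenE)
  then have "x = u + v" and "y = u - v"
    by auto
  with xy show "\<exists>uv\<in>two_sq_reps n. xy = (case uv of (u, v) \<Rightarrow> (u + v, u - v))"
    by (intro bexI [of _ "(u, v)"]) (auto simp: two_sq_reps_def power2_eq_square algebra_simps)
qed (auto simp: two_sq_reps_def power2_eq_square algebra_simps)

lemma sum_two_sq_reps_double:
  "(\<Sum>(x, y)\<in>two_sq_reps (2 * n). g x y) = (\<Sum>(u, v)\<in>two_sq_reps n. g (u + v) (u - v))"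
  by (subst sum.reindex_bij_betw [OF bij_betw_two_sq_reps, symmetric]) (simp add: case_prod_unfold)

lemma theta3_square_add_theta4_square: "theta3 ^ 2 + theta4 ^ 2 = 2 * dilate (theta3 ^ 2)"
proof (rule fps_ext)
  fix n
  have "(theta3 ^ 2 + theta4 ^ 2) $ n = (\<Sum>(x, y)\<in>two_sq_reps n. 1 + (-1) powi (x + y))"
    by (simp add: theta3_def theta4_def power2_eq_square square_series_mult_nth sum.distrib
        case_prod_unfold power_int_add)
  also have "\<dots> = (\<Sum>(x, y)\<in>two_sq_reps n. if even n then 2 else 0)"
    by (intro sum.cong refl)
      (auto simp: power_int_minus_left dest: even_two_sq_reps)
  also have "\<dots> = (2 * dilate (theta3 ^ 2)) $ n"
    using bij_betw_same_card [OF bij_betw_two_sq_reps, of "n div 2"]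
    by (auto simp: dilate_nth theta3_def power2_eq_square square_series_mult_nth numeral_fps_const
        case_prod_unfold simp del: dilate_mult dilate_power)
  finally show "(theta3 ^ 2 + theta4 ^ 2) $ n = (2 * dilate (theta3 ^ 2)) $ n" .
qed

lemma theta4_mult_theta3: "theta4 * theta3 = dilate (theta4 ^ 2)"
proof (rule fps_ext)
  fix n
  have theta43_nth: "(theta4 * theta3) $ n = (\<Sum>(x, y)\<in>two_sq_reps n. (-1) powi x)"
    by (simp add: theta3_def theta4_def square_series_mult_nth)
  show "(theta4 * theta3) $ n = dilate (theta4 ^ 2) $ n"
  proof (cases "even n")
    case True
    then obtain m where n: "n = 2 * m" by (elim evenE)
    have "(theta4 * theta3) $ n = (\<Sum>(u, v)\<in>two_sq_reps m. (-1) powi u * (-1) powi v)"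
      unfolding theta43_nth unfolding n sum_two_sq_reps_double by (simp add: power_int_add)
    also have "\<dots> = (theta4 ^ 2) $ m"
      by (simp add: theta4_def power2_eq_square square_series_mult_nth)
    finally show ?thesis
      by (simp add: n dilate_nth del: dilate_power)
  next
    case False
    have "bij_betw prod.swap (two_sq_reps n) (two_sq_reps n)"
      by (rule bij_betw_byWitness [where f' = prod.swap]) (auto simp: two_sq_reps_def)
    then have "(theta4 * theta3) $ n = (\<Sum>(x, y)\<in>two_sq_reps n. (-1) powi y)"
      unfolding theta43_nth
      by (subst sum.reindex_bij_betw [symmetric]) (auto simp: case_prod_unfold)
    also have "\<dots> = (\<Sum>(x, y)\<in>two_sq_reps n. - ((-1) powi x))"
      using False by (intro sum.cong refl)
        (auto simp: power_int_minus_left dest: even_two_sq_reps split: prod.split)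
    also have "\<dots> = - (theta4 * theta3) $ n"
      by (simp add: theta43_nth case_prod_unfold sum_negf)
    finally show ?thesis
      using False by (simp add: dilate_nth del: dilate_power)
  qed
qed

section \<open>The identity of Gauss for the alternating theta series\<close>

lemma fps_X_power_dvd_iff: "fps_X ^ n dvd f \<longleftrightarrow> (\<forall>i<n. f $ i = 0)"
  for f :: "'a::comm_ring_1 fps"
proof
  assume "\<forall>i<n. f $ i = 0"
  then have "f = fps_X ^ n * fps_shift n f"
    by (auto simp: fps_eq_iff fps_X_power_mult_nth)
  then show "fps_X ^ n dvd f" by (rule dvdI)
qed (auto simp: fps_X_power_mult_nth elim!: dvdE)

lemma fps_mod_X_power_eq_iff:
  "f mod fps_X ^ n = g mod fps_X ^ n \<longleftrightarrow> (\<forall>i<n. f $ i = g $ i)" for f g :: "'a::field fps"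
  by (simp add: mod_eq_dvd_iff fps_X_power_dvd_iff)

lemma fps_eqI_mod_X_power:
  fixes f g :: "'a::field fps"
  assumes "\<And>n. f mod fps_X ^ Suc n = g mod fps_X ^ Suc n"
  shows "f = g"
proof (rule fps_ext)
  show "f $ n = g $ n" for n
    using assms [of n] unfolding fps_mod_X_power_eq_iff by simp
qed

lemma dilate_mod_X_power:
  fixes f g :: "'a::field fps"
  assumes "f mod fps_X ^ n = g mod fps_X ^ n"
  shows "dilate f mod fps_X ^ n = dilate g mod fps_X ^ n"
  using assms by (auto simp: fps_mod_X_power_eq_iff dilate_nth)

definition euler_poly :: "nat \<Rightarrow> rat fps" where
  "euler_poly n = (\<Prod>j=1..n. 1 - fps_X ^ j)"

definition euler :: "rat fps" where
  "euler = Abs_fps (\<lambda>n. euler_poly n $ n)"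

lemma euler_poly_0 [simp]: "euler_poly 0 = 1"
  by (simp add: euler_poly_def)

lemma euler_poly_Suc: "euler_poly (Suc n) = euler_poly n * (1 - fps_X ^ Suc n)"
  by (simp add: euler_poly_def)

lemma euler_poly_nth_0 [simp]: "euler_poly n $ 0 = 1"
  by (induction n) (simp_all add: euler_poly_Suc)

lemma euler_nth_0 [simp]: "euler $ 0 = 1"
  by (simp add: euler_def)

lemma euler_poly_nth_stable:
  assumes "i \<le> m" "m \<le> n"
  shows "euler_poly n $ i = euler_poly m $ i"
  using assms(2,1)
proof (induction n rule: dec_induct)
  case (step n)
  then show ?case
    by (simp add: euler_poly_Suc right_diff_distrib fps_X_power_mult_right_nth del: power_Suc)
qed simp

lemma euler_mod_X_power:
  assumes "n \<le> m"
  shows "euler mod fps_X ^ Suc n = euler_poly m mod fps_X ^ Suc n"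
  unfolding fps_mod_X_power_eq_iff
proof (intro allI impI)
  fix i assume "i < Suc n"
  then show "euler $ i = euler_poly m $ i"
    using assms euler_poly_nth_stable [of i i m] by (simp add: euler_def)
qed

text \<open>Extending the reciprocals by \<open>0\<close> to negative indices makes all boundary terms of the
  telescoping sum below vanish.\<close>

definition inv_euler_poly :: "int \<Rightarrow> rat fps" where
  "inv_euler_poly m = (if m < 0 then 0 else inverse (euler_poly (nat m)))"

lemma inv_euler_poly_neg [simp]: "m < 0 \<Longrightarrow> inv_euler_poly m = 0"
  by (simp add: inv_euler_poly_def)

lemma euler_poly_mult_inv: "euler_poly n * inv_euler_poly (int n) = 1"
  by (simp add: inv_euler_poly_def inverse_mult_eq_1')

lemma inv_euler_poly_pred:
  assumes "m \<ge> 0"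
  shows "inv_euler_poly (m - 1) = (1 - fps_X ^ nat m) * inv_euler_poly m"
proof (cases "m = 0")
  case False
  then obtain n where m: "m = int (Suc n)"
    using assms by (metis nonneg_int_cases not0_implies_Suc of_nat_0)
  have "inv_euler_poly (int n)
      = inv_euler_poly (int n) * (euler_poly (Suc n) * inv_euler_poly (int (Suc n)))"
    by (simp only: euler_poly_mult_inv mult_1_right)
  also have "\<dots> = (euler_poly n * inv_euler_poly (int n))
      * ((1 - fps_X ^ Suc n) * inv_euler_poly (int (Suc n)))"
    unfolding euler_poly_Suc by (simp only: mult_ac)
  also have "\<dots> = (1 - fps_X ^ Suc n) * inv_euler_poly (int (Suc n))"
    by (simp only: euler_poly_mult_inv mult_1_left)
  finally show ?thesis
    unfolding m nat_int by simp
qed simp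

lemma euler_mult_inv_euler_poly:
  assumes "m \<ge> int n"
  shows "(euler * inv_euler_poly m) mod fps_X ^ Suc n = 1 mod fps_X ^ Suc n"
proof -
  have "(euler * inv_euler_poly m) mod fps_X ^ Suc n
      = (euler_poly (nat m) * inv_euler_poly (int (nat m))) mod fps_X ^ Suc n"
    using assms by (intro mod_mult_cong euler_mod_X_power) auto
  then show ?thesis
    by (simp only: euler_poly_mult_inv)
qed

definition theta4_term :: "int \<Rightarrow> rat fps" where
  "theta4_term k = fps_const ((-1) powi k) * fps_X ^ nat (k ^ 2)"

definition gauss_term :: "int \<Rightarrow> int \<Rightarrow> rat fps" where
  "gauss_term M k = theta4_term k * (inv_euler_poly (M - k) * inv_euler_poly (M + k))"

definition gauss_sum :: "nat \<Rightarrow> rat fps" where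
  "gauss_sum N = (\<Sum>k=- int N..int N. gauss_term (int N) k)"

definition gauss_certificate :: "int \<Rightarrow> int \<Rightarrow> rat fps" where
  "gauss_certificate M k = fps_const ((-1) powi k) * fps_X ^ nat (k ^ 2 + k + M) *
     (inv_euler_poly (M - k - 1) * inv_euler_poly (M + k))"

lemma gauss_term_telescope:
  assumes "\<bar>k\<bar> \<le> M"
  shows "(1 - fps_X ^ nat (2 * M)) * gauss_term M k - gauss_term (M - 1) k
    = gauss_certificate M k - gauss_certificate M (k - 1)"
proof -
  define c where "c = fps_const ((-1 :: rat) powi k)"
  define x1 where "x1 = (fps_X ^ nat (M - k) :: rat fps)"
  define x2 where "x2 = (fps_X ^ nat (M + k) :: rat fps)"
  define y where "y = (fps_X ^ nat (k ^ 2) :: rat fps)"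
  define P where "P = inv_euler_poly (M - k)"
  define Q where "Q = inv_euler_poly (M + k)"
  have "nat (2 * M) = nat (M - k) + nat (M + k)"
    using assms by linarith
  then have x1x2: "fps_X ^ nat (2 * M) = x1 * x2"
    by (simp add: x1_def x2_def power_add)
  have P_pred: "inv_euler_poly (M - k - 1) = (1 - x1) * P"
    and Q_pred: "inv_euler_poly (M + k - 1) = (1 - x2) * Q"
    unfolding P_def Q_def x1_def x2_def using assms by (intro inv_euler_poly_pred; linarith)+
  have "nat (k ^ 2 + k + M) = nat (k ^ 2) + nat (M + k)"
    using assms by (simp add: add.commute flip: nat_add_distrib)
  then have "gauss_certificate M k = c * (y * x2) * ((1 - x1) * P * Q)"
    unfolding gauss_certificate_def P_pred by (simp add: c_def x2_def y_def Q_def power_add)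
  moreover have "nat ((k - 1) ^ 2 + (k - 1) + M) = nat (k ^ 2) + nat (M - k)"
    using assms by (subst nat_add_distrib [symmetric]) (auto simp: algebra_simps power2_eq_square)
  then have "gauss_certificate M (k - 1) = - c * (y * x1) * (P * ((1 - x2) * Q))"
    unfolding gauss_certificate_def add_diff_eq Q_pred
    by (simp add: c_def x1_def y_def P_def power_add power_int_diff)
  moreover have "gauss_term M k = c * y * (P * Q)"
    by (simp add: gauss_term_def theta4_term_def c_def y_def P_def Q_def)
  moreover have "gauss_term (M - 1) k = c * y * ((1 - x1) * P * ((1 - x2) * Q))"
    unfolding gauss_term_def P_pred [symmetric] Q_pred [symmetric]
    by (simp add: theta4_term_def c_def y_def algebra_simps)
  ultimately show ?thesis
    unfolding x1x2 by (simp only:) (simp add: algebra_simps)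
qed

lemma sum_gauss_certificate_telescope:
  "(\<Sum>k=-M..M. gauss_certificate M k - gauss_certificate M (k - 1)) = 0"
proof -
  have "(\<Sum>k=-M..M. gauss_certificate M (k - 1)) = (\<Sum>k=-M-1..M-1. gauss_certificate M k)"
    by (rule sum.reindex_bij_witness [of _ "\<lambda>k. k + 1" "\<lambda>k. k - 1"]) auto
  also have "\<dots> = (\<Sum>k=-M..M-1. gauss_certificate M k)"
    by (rule sum.mono_neutral_right) (auto simp: gauss_certificate_def)
  also have "\<dots> = (\<Sum>k=-M..M. gauss_certificate M k)"
    by (rule sum.mono_neutral_left) (auto simp: gauss_certificate_def)
  finally show ?thesis
    by (simp add: sum_subtractf)
qed

lemma gauss_sum_Suc: "(1 - fps_X ^ (2 * Suc N)) * gauss_sum (Suc N) = gauss_sum N"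
proof -
  define M where "M = int (Suc N)"
  have M: "nat (2 * M) = 2 * Suc N" "int N = M - 1"
    by (simp_all add: M_def)
  have "gauss_sum N = (\<Sum>k=-M..M. gauss_term (M - 1) k)"
    unfolding gauss_sum_def M by (intro sum.mono_neutral_left) (auto simp: gauss_term_def)
  then have "(1 - fps_X ^ (2 * Suc N)) * gauss_sum (Suc N) - gauss_sum N
      = (\<Sum>k=-M..M. (1 - fps_X ^ nat (2 * M)) * gauss_term M k - gauss_term (M - 1) k)"
    by (simp only: gauss_sum_def [of "Suc N"] M_def [symmetric] M sum_distrib_left sum_subtractf)
  also have "\<dots> = (\<Sum>k=-M..M. gauss_certificate M k - gauss_certificate M (k - 1))"
    by (intro sum.cong refl gauss_term_telescope) auto
  also have "\<dots> = 0"
    by (rule sum_gauss_certificate_telescope)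
  finally show ?thesis
    by simp
qed

lemma dilate_euler_poly_mult_gauss_sum: "dilate (euler_poly N) * gauss_sum N = 1"
proof (induction N)
  case 0
  then show ?case by (simp add: gauss_sum_def gauss_term_def theta4_term_def inv_euler_poly_def)
next
  case (Suc N)
  have "dilate (euler_poly (Suc N)) * gauss_sum (Suc N)
      = dilate (euler_poly N) * ((1 - fps_X ^ (2 * Suc N)) * gauss_sum (Suc N))"
    by (simp add: euler_poly_Suc power_mult [symmetric] mult.assoc del: power_Suc)
  then show ?case by (simp only: gauss_sum_Suc Suc.IH)
qed

lemma theta4_mod_X_power:
  "theta4 mod fps_X ^ Suc N
    = (\<Sum>k=- int N..int N. theta4_term k) mod fps_X ^ Suc N"
  unfolding fps_mod_X_power_eq_iff
proof (intro allI impI)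
  fix n assume "n < Suc N"
  then have "sq_reps n \<subseteq> {- int N..int N}"
    using sq_reps_subset [of n] by fastforce
  then have "{- int N..int N} \<inter> sq_reps n = sq_reps n"
    by blast
  then have "theta4 $ n = (\<Sum>k=- int N..int N. if k \<in> sq_reps n then (-1) powi k else 0)"
    by (simp add: theta4_def square_series_def sum.inter_restrict [symmetric])
  also have "\<dots> = (\<Sum>k=- int N..int N. theta4_term k) $ n"
    unfolding fps_sum_nth theta4_term_def
    by (intro sum.cong) (auto simp: sq_reps_def fps_X_power_nth)
  finally show "theta4 $ n = (\<Sum>k=- int N..int N. theta4_term k) $ n" .
qed

lemma gauss_term_mod_X_power:
  "(euler ^ 2 * gauss_term (int (2 * n)) k) mod fps_X ^ Suc n = theta4_term k mod fps_X ^ Suc n"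
proof -
  define P where "P = euler * inv_euler_poly (int (2 * n) - k)"
  define Q where "Q = euler * inv_euler_poly (int (2 * n) + k)"
  have "euler ^ 2 * gauss_term (int (2 * n)) k = theta4_term k * (P * Q)"
    by (simp add: gauss_term_def P_def Q_def power2_eq_square mult_ac)
  moreover have "(theta4_term k * (P * Q)) mod fps_X ^ Suc n
      = (theta4_term k * (1 * 1)) mod fps_X ^ Suc n"
  proof (cases "\<bar>k\<bar> \<le> int n")
    case True
    then show ?thesis
      unfolding P_def Q_def by (intro mod_mult_cong refl euler_mult_inv_euler_poly) auto
  next
    case False
    then have "Suc n \<le> nat (k ^ 2)"
      using abs_le_square_int [of k] by linarith
    then have "fps_X ^ Suc n dvd theta4_term k"
      unfolding theta4_term_def by (intro dvd_mult le_imp_power_dvd)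
    then show ?thesis
      by (metis dvd_mult2 dvd_imp_mod_0)
  qed
  ultimately show ?thesis
    by simp
qed

lemma gauss_sum_mod_X_power:
  "(euler ^ 2 * gauss_sum (2 * n)) mod fps_X ^ Suc n = theta4 mod fps_X ^ Suc n"
proof -
  have "(euler ^ 2 * gauss_sum (2 * n)) mod fps_X ^ Suc n
      = (\<Sum>k=- int (2 * n)..int (2 * n). theta4_term k) mod fps_X ^ Suc n"
    unfolding gauss_sum_def sum_distrib_left
    by (subst (1 2) mod_sum_eq [symmetric]) (simp only: gauss_term_mod_X_power)
  also have "\<dots> = theta4 mod fps_X ^ Suc n"
    using theta4_mod_X_power [of "2 * n"]
    by (auto simp: fps_mod_X_power_eq_iff simp del: power_Suc)
  finally show ?thesis .
qed

lemma theta4_mult_dilate_euler: "theta4 * dilate euler = euler ^ 2"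
proof (rule fps_eqI_mod_X_power)
  fix n
  have "(theta4 * dilate euler) mod fps_X ^ Suc n
      = (euler ^ 2 * gauss_sum (2 * n) * dilate (euler_poly (2 * n))) mod fps_X ^ Suc n"
    by (intro mod_mult_cong gauss_sum_mod_X_power [symmetric] dilate_mod_X_power
        euler_mod_X_power) simp
  also have "euler ^ 2 * gauss_sum (2 * n) * dilate (euler_poly (2 * n)) = euler ^ 2"
    by (simp add: mult.assoc mult.commute [of "gauss_sum _"] dilate_euler_poly_mult_gauss_sum)
  finally show "(theta4 * dilate euler) mod fps_X ^ Suc n = euler ^ 2 mod fps_X ^ Suc n" .
qed

section \<open>The eta product in terms of theta series\<close>

lemma sq_reps_0: "sq_reps 0 = {0}" and sq_reps_1: "sq_reps (Suc 0) = {1, -1}"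
  by (auto simp: sq_reps_def power2_eq_1_iff)

lemma theta_nth_0 [simp]: "theta3 $ 0 = 1" "theta4 $ 0 = 1"
  and theta_nth_1 [simp]: "theta3 $ Suc 0 = 2" "theta4 $ Suc 0 = -2"
  by (simp_all add: theta3_def theta4_def square_series_def sq_reps_0 sq_reps_1)

lemma theta_neq_0 [simp]: "theta3 \<noteq> 0" "theta4 \<noteq> 0"
  using theta_nth_0 by (metis fps_zero_nth zero_neq_one)+

definition eta_prod :: "rat fps" where
  "eta_prod = dilate euler ^ 12"

lemma eta_prod_nth_0 [simp]: "eta_prod $ 0 = 1"
  by (simp add: eta_prod_def fps_power_zeroth)

definition fps_of_int_poly :: "int poly \<Rightarrow> 'a::comm_ring_1 fps" where
  "fps_of_int_poly q = Abs_fps (\<lambda>n. of_int (coeff q n))"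

lemma fps_of_int_poly_1: "fps_of_int_poly 1 = 1"
  by (simp add: fps_of_int_poly_def fps_eq_iff)

lemma fps_of_int_poly_mult: "fps_of_int_poly (q * r) = fps_of_int_poly q * fps_of_int_poly r"
  by (simp add: fps_of_int_poly_def fps_eq_iff coeff_mult fps_mult_nth atLeast0AtMost)

lemma fps_of_int_poly_power: "fps_of_int_poly (q ^ n) = fps_of_int_poly q ^ n"
  by (induction n) (simp_all add: fps_of_int_poly_1 fps_of_int_poly_mult)

lemma fps_of_int_poly_prod: "fps_of_int_poly (prod f A) = (\<Prod>x\<in>A. fps_of_int_poly (f x))"
  by (induction A rule: infinite_finite_induct)
    (simp_all add: fps_of_int_poly_1 fps_of_int_poly_mult)

lemma fps_of_int_poly_one_minus_monom: "fps_of_int_poly (1 - monom 1 k) = 1 - fps_X ^ k"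
  by (auto simp: fps_of_int_poly_def fps_eq_iff fps_X_power_nth)

lemma dilate_euler_poly: "dilate (euler_poly n) = (\<Prod>j=1..n. 1 - fps_X ^ (2 * j))"
  by (induction n) (simp_all add: euler_poly_Suc del: power_Suc flip: power_mult)

lemma eta12_coeff_eq_eta_prod_nth:
  assumes "n > 0"
  shows "rat_of_int (eta12_coeff n) = eta_prod $ (n - 1)"
proof -
  have "rat_of_int (eta12_coeff n)
      = fps_of_int_poly (\<Prod>m\<in>{1..n}. (1 - monom 1 (2 * m)) ^ 12) $ (n - 1)"
    using assms by (simp add: eta12_coeff_def fps_of_int_poly_def)
  also have "\<dots> = (dilate (euler_poly n) ^ 12) $ (n - 1)"
    by (simp only: fps_of_int_poly_prod fps_of_int_poly_power fps_of_int_poly_one_minus_monom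
        dilate_euler_poly prod_power_distrib)
  also have "\<dots> = eta_prod $ (n - 1)"
  proof -
    have "dilate (euler_poly n) mod fps_X ^ Suc n = dilate euler mod fps_X ^ Suc n"
      by (intro dilate_mod_X_power euler_mod_X_power [symmetric]) simp
    then have "dilate (euler_poly n) ^ 12 mod fps_X ^ Suc n = dilate euler ^ 12 mod fps_X ^ Suc n"
      by (metis power_mod)
    then show ?thesis
      unfolding eta_prod_def fps_mod_X_power_eq_iff by simp
  qed
  finally show ?thesis .
qed

lemma eta_prod_square: "eta_prod ^ 2 = (theta3 * theta4) ^ 6 * dilate eta_prod"
proof -
  have "eta_prod ^ 2 = dilate (euler ^ 2) ^ 12"
    by (simp add: eta_prod_def flip: power_mult)
  also have "\<dots> = dilate (theta4 ^ 2) ^ 6 * dilate eta_prod"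
    by (simp add: theta4_mult_dilate_euler [symmetric] eta_prod_def power_mult_distrib
        flip: power_mult)
  finally show ?thesis
    by (simp only: theta4_mult_theta3 [symmetric] mult.commute [of theta4])
qed

lemma eta_prod_theta:
  "16 * (fps_X * eta_prod) = theta3 ^ 4 * theta4 ^ 4 * (theta3 ^ 4 - theta4 ^ 4)"
  (is "_ = ?M")
proof -
  define m where "m = fps_shift 1 ?M"
  have "?M $ 0 = 0"
    by (simp add: fps_power_zeroth)
  then have M: "?M = fps_X * m"
    by (auto simp: m_def fps_eq_iff)
  have "m $ 0 = 16"
    by (simp add: m_def fps_mult_nth_1 fps_power_first_eq [unfolded One_nat_def] fps_power_zeroth)
  have m_square: "m ^ 2 * 1 = 16 * (theta3 * theta4) ^ 6 * dilate m"
  proof -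
    have "dilate ?M = fps_X ^ 2 * dilate m"
      unfolding M by simp
    moreover have "dilate ?M = dilate (theta3 ^ 2) ^ 2 * dilate (theta4 ^ 2) ^ 2
        * (dilate (theta3 ^ 2) ^ 2 - dilate (theta4 ^ 2) ^ 2)"
      by (simp flip: power_mult)
    ultimately have "fps_X ^ 2 * m ^ 2 = fps_X ^ 2 * (16 * (theta3 * theta4) ^ 6 * dilate m)"
      using M theta3_square_add_theta4_square theta4_mult_theta3 by algebra
    then show ?thesis
      by simp
  qed
  have "m = 16 * eta_prod"
  proof (rule dilate_equation_unique [OF m_square])
    show "(16 * eta_prod) ^ 2 * 1 = 16 * (theta3 * theta4) ^ 6 * dilate (16 * eta_prod)"
      by (simp add: power_mult_distrib eta_prod_square)
  qed (use \<open>m $ 0 = 16\<close> in \<open>simp_all add: numeral_fps_const\<close>)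
  then show ?thesis
    by (simp add: M)
qed

section \<open>The Hauptmodul\<close>

text \<open>The series \<open>hauptmodul\<close> is one sixteenth of the modular lambda function. Its definition by the
  eta quotient instead of \<open>(\<theta>\<^sub>3\<^sup>4 - \<theta>\<^sub>4\<^sup>4) / (16 \<theta>\<^sub>3\<^sup>4)\<close> makes its integrality evident.\<close>

definition hauptmodul_unit :: "rat fps" where
  "hauptmodul_unit = eta_prod * inverse (theta3 ^ 8 * theta4 ^ 4)"

definition hauptmodul :: "rat fps" where
  "hauptmodul = fps_X * hauptmodul_unit"

lemma hauptmodul_unit_nth_0 [simp]: "hauptmodul_unit $ 0 = 1"
  by (simp add: hauptmodul_unit_def fps_power_zeroth)

lemma hauptmodul_nth_0 [simp]: "hauptmodul $ 0 = 0"
  by (simp add: hauptmodul_def)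

lemma hauptmodul_neq_0 [simp]: "hauptmodul \<noteq> 0"
proof -
  have "hauptmodul_unit \<noteq> 0"
    using hauptmodul_unit_nth_0 by (metis fps_zero_nth zero_neq_one)
  then show ?thesis
    by (simp add: hauptmodul_def)
qed

lemma hauptmodul_eta: "hauptmodul * (theta3 ^ 8 * theta4 ^ 4) = fps_X * eta_prod"
  by (simp add: hauptmodul_def hauptmodul_unit_def mult.assoc inverse_mult_eq_1 fps_power_zeroth)

lemma hauptmodul_theta: "16 * hauptmodul * theta3 ^ 4 = theta3 ^ 4 - theta4 ^ 4"
proof -
  have "(theta3 ^ 4 * theta4 ^ 4) * (16 * hauptmodul * theta3 ^ 4)
      = (theta3 ^ 4 * theta4 ^ 4) * (theta3 ^ 4 - theta4 ^ 4)"
    using eta_prod_theta hauptmodul_eta by algebra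
  then show ?thesis
    unfolding mult_cancel_left by simp
qed

definition landen_param :: "rat fps" where
  "landen_param = fps_const (1 / 8) * (theta3 ^ 2 - theta4 ^ 2) * inverse (dilate (theta3 ^ 2))"

lemma landen_param_nth_0 [simp]: "landen_param $ 0 = 0"
  by (simp add: landen_param_def fps_power_zeroth)

lemma landen_param_theta3: "(1 + 4 * landen_param) * dilate (theta3 ^ 2) = theta3 ^ 2"
  and landen_param_theta4: "(1 - 4 * landen_param) * dilate (theta3 ^ 2) = theta4 ^ 2"
proof -
  have "inverse (dilate (theta3 ^ 2)) * dilate (theta3 ^ 2) = 1"
    by (intro inverse_mult_eq_1) (simp add: fps_power_zeroth)
  moreover have "8 * fps_const (1 / 8) = (1 :: rat fps)"
    by (simp add: numeral_fps_const)
  ultimately have "8 * landen_param * dilate (theta3 ^ 2) = theta3 ^ 2 - theta4 ^ 2"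
    unfolding landen_param_def by algebra
  then have "2 * ((1 + 4 * landen_param) * dilate (theta3 ^ 2)) = 2 * theta3 ^ 2"
    and "2 * ((1 - 4 * landen_param) * dilate (theta3 ^ 2)) = 2 * theta4 ^ 2"
    using theta3_square_add_theta4_square by algebra+
  then show "(1 + 4 * landen_param) * dilate (theta3 ^ 2) = theta3 ^ 2"
    and "(1 - 4 * landen_param) * dilate (theta3 ^ 2) = theta4 ^ 2"
    by simp_all
qed

lemma dilate_hauptmodul: "dilate hauptmodul = landen_param ^ 2"
proof -
  define A where "A = dilate (theta3 ^ 2)"
  define B where "B = dilate (theta4 ^ 2)"
  have "16 * dilate hauptmodul * A ^ 2 = A ^ 2 - B ^ 2"
    using arg_cong [OF hauptmodul_theta, of dilate] by (simp add: A_def B_def flip: power_mult)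
  moreover have "B ^ 2 = theta3 ^ 2 * theta4 ^ 2"
    unfolding B_def theta4_mult_theta3 [symmetric] by (simp add: power_mult_distrib)
  ultimately have "16 * A ^ 2 * dilate hauptmodul = 16 * A ^ 2 * landen_param ^ 2"
    using landen_param_theta3 [folded A_def] landen_param_theta4 [folded A_def] by algebra
  then show ?thesis by (simp add: A_def)
qed

lemma hauptmodul_landen_param: "hauptmodul * (1 + 4 * landen_param) ^ 2 = landen_param"
proof -
  define A where "A = dilate (theta3 ^ 2)"
  have "16 * A ^ 2 * (hauptmodul * (1 + 4 * landen_param) ^ 2) = 16 * A ^ 2 * landen_param"
    using hauptmodul_theta landen_param_theta3 [folded A_def] landen_param_theta4 [folded A_def]
    by algebra
  then show ?thesis by (simp add: A_def)
qed

section \<open>Hypergeometric parametrisation of the eta quotient\<close>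

abbreviation central_binomial :: "nat \<Rightarrow> nat" where
  "central_binomial n \<equiv> 2 * n choose n"

definition binom_sq_fps :: "rat fps" where
  "binom_sq_fps = Abs_fps (\<lambda>n. of_nat (central_binomial n ^ 2))"

lemma Suc_times_central_binomial:
  "Suc n * central_binomial (Suc n) = 2 * (2 * n + 1) * central_binomial n"
proof -
  have "central_binomial (Suc n) = 2 * (Suc (2 * n) choose n)"
    using binomial_symmetric [of n "Suc (2 * n)"] by simp
  moreover have "Suc n * (Suc (2 * n) choose n) = Suc (2 * n) * central_binomial n"
    using Suc_times_binomial_eq [of "2 * n" n] binomial_symmetric [of n "Suc (2 * n)"] by simp
  ultimately show ?thesis
    by (metis Suc_eq_plus1 mult.assoc mult.left_commute)
qed

lemma central_binomial_square_Suc: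
  "Suc n ^ 2 * central_binomial (Suc n) ^ 2 = 4 * (2 * n + 1) ^ 2 * central_binomial n ^ 2"
  using arg_cong [OF Suc_times_central_binomial [of n], of "\<lambda>x. x ^ 2"]
  by (simp only: power_mult_distrib) simp

lemma binom_sq_fps_nth_0 [simp]: "binom_sq_fps $ 0 = 1"
  by (simp add: binom_sq_fps_def)

lemma binom_sq_fps_Suc:
  "of_nat (Suc n) ^ 2 * binom_sq_fps $ Suc n = 4 * (2 * of_nat n + 1) ^ 2 * binom_sq_fps $ n"
  using arg_cong [OF central_binomial_square_Suc [of n], of rat_of_nat]
  by (simp only: binom_sq_fps_def fps_nth_Abs_fps of_nat_mult of_nat_power of_nat_add
      of_nat_numeral of_nat_1)

lemma numeral_X_mult_nth_Suc:
  "(numeral k * fps_X * f) $ Suc n = numeral k * f $ n" for f :: "'a::comm_ring_1 fps"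
  by (simp add: numeral_fps_const mult.assoc)

lemma binom_sq_fps_ode: "XD ((1 - 16 * fps_X) * XD binom_sq_fps) = 4 * fps_X * binom_sq_fps"
proof (rule fps_ext)
  fix n
  show "XD ((1 - 16 * fps_X) * XD binom_sq_fps) $ n = (4 * fps_X * binom_sq_fps) $ n"
  proof (cases n)
    case (Suc m)
    then show ?thesis
      using binom_sq_fps_Suc [of m]
      unfolding Suc fps_XD_nth left_diff_distrib mult_1_left fps_sub_nth numeral_X_mult_nth_Suc
      by (simp add: algebra_simps power2_eq_square)
  qed (simp add: mult.assoc)
qed

lemma dilate_binom_sq_fps_ode:
  "XD ((1 - 16 * fps_X ^ 2) * XD (dilate binom_sq_fps)) = 16 * fps_X ^ 2 * dilate binom_sq_fps"
proof -
  have "(1 - 16 * fps_X ^ 2) * XD (dilate binom_sq_fps)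
      = 2 * dilate ((1 - 16 * fps_X) * XD binom_sq_fps)"
    by (simp add: XD_dilate algebra_simps)
  then have "XD ((1 - 16 * fps_X ^ 2) * XD (dilate binom_sq_fps))
      = 2 * (2 * dilate (XD ((1 - 16 * fps_X) * XD binom_sq_fps)))"
    by (simp only: XD_mult [of 2] XD_numeral XD_dilate) simp
  then show ?thesis
    unfolding binom_sq_fps_ode by (simp add: mult_ac)
qed

lemma binom_sq_fps_landen_ode:
  fixes \<tau> \<kappa> :: "rat fps"
  assumes "\<tau> $ 0 = 0" and XD_\<tau>: "XD \<tau> = \<kappa> * \<tau>" and \<kappa>: "1 - 16 * \<tau> = \<kappa> ^ 2"
  shows "XD (\<kappa> * XD (binom_sq_fps oo \<tau>)) = 4 * \<kappa> * \<tau> * (binom_sq_fps oo \<tau>)"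
proof -
  have "\<kappa> * XD (binom_sq_fps oo \<tau>) = (1 - 16 * \<tau>) * (XD binom_sq_fps oo \<tau>)"
    unfolding \<kappa> XD_compose [OF assms(1,2)] by (simp add: power2_eq_square)
  also have "\<dots> = ((1 - 16 * fps_X) * XD binom_sq_fps) oo \<tau>"
    using assms(1) by (simp add: fps_compose_mult_distrib fps_compose_sub_distrib)
  finally have "XD (\<kappa> * XD (binom_sq_fps oo \<tau>)) = \<kappa> * ((4 * fps_X * binom_sq_fps) oo \<tau>)"
    by (simp only: XD_compose [OF assms(1,2)] binom_sq_fps_ode)
  then show ?thesis
    using assms(1) by (simp add: fps_compose_mult_distrib)
qed

text \<open>After division by \<open>1 + 4x\<close>, the left-hand side of Landen's transformation satisfies the
  differential equation of \<open>F(x\<^sup>2)\<close>.\<close>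

lemma binom_sq_fps_landen:
  "binom_sq_fps oo (fps_X * inverse (1 + 4 * fps_X) ^ 2) = (1 + 4 * fps_X) * dilate binom_sq_fps"
proof -
  define i where "i = inverse (1 + 4 * fps_X :: rat fps)"
  define \<tau> where "\<tau> = fps_X * i ^ 2"
  define \<kappa> where "\<kappa> = (1 - 4 * fps_X) * i"
  define G where "G = binom_sq_fps oo \<tau>"
  define U where "U = \<kappa> * XD G"
  define P where "P = i * G"
  have i_eq: "(1 + 4 * fps_X) * i = 1"
    unfolding i_def by (rule inverse_mult_eq_1') simp
  have XD_i: "XD i = - 4 * fps_X * i ^ 2"
    unfolding i_def by (subst XD_inverse) (simp_all add: XD_mult)
  have "XD \<tau> = \<kappa> * \<tau>"
    unfolding \<tau>_def \<kappa>_def XD_mult XD_square XD_i XD_X using i_eq by algebra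
  moreover have "1 - 16 * \<tau> = \<kappa> ^ 2"
    unfolding \<tau>_def \<kappa>_def using i_eq by algebra
  ultimately have XD_U: "XD U = 4 * \<kappa> * \<tau> * G"
    unfolding U_def G_def by (intro binom_sq_fps_landen_ode) (simp_all add: \<tau>_def)
  have XD_P: "XD P = - 4 * fps_X * i * P + i * XD G"
    unfolding P_def XD_mult XD_i by (simp add: power2_eq_square mult_ac)
  then have "(1 - 16 * fps_X ^ 2) * XD P = (1 + 4 * fps_X) * U - 4 * fps_X * (1 - 4 * fps_X) * P"
    unfolding U_def \<kappa>_def using i_eq by algebra
  then have "XD ((1 - 16 * fps_X ^ 2) * XD P)
      = XD ((1 + 4 * fps_X) * U) - XD (4 * fps_X * (1 - 4 * fps_X) * P)"
    by simp
  also have "\<dots> = 16 * fps_X ^ 2 * P"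
    unfolding XD_mult XD_diff fps_XD_add XD_1 XD_X XD_numeral XD_U XD_P
    using i_eq unfolding P_def U_def \<kappa>_def \<tau>_def by algebra
  finally have "P = dilate binom_sq_fps"
    by (rule XD_ode_unique [OF _ dilate_binom_sq_fps_ode]) (simp_all add: P_def G_def i_def)
  moreover have "(1 + 4 * fps_X) * P = G"
    using i_eq by (simp add: P_def flip: mult.assoc)
  ultimately show ?thesis
    by (simp add: G_def \<tau>_def i_def)
qed

lemma hauptmodul_eq_compose:
  "hauptmodul = (fps_X * inverse (1 + 4 * fps_X) ^ 2) oo landen_param"
proof -
  define s where "s = landen_param"
  have s_nth_0: "s $ 0 = 0" by (simp add: s_def)
  then have "(fps_X * inverse (1 + 4 * fps_X) ^ 2) oo s = s * inverse (1 + 4 * s) ^ 2"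
    by (simp add: fps_compose_mult_distrib fps_compose_power [symmetric] fps_inverse_compose
        fps_compose_add_distrib)
  moreover have "(1 + 4 * s) * inverse (1 + 4 * s) = 1"
    using s_nth_0 by (intro inverse_mult_eq_1') simp
  moreover have "hauptmodul * (1 + 4 * s) ^ 2 = s"
    unfolding s_def by (rule hauptmodul_landen_param)
  ultimately show ?thesis
    unfolding s_def [symmetric] by algebra
qed

lemma binom_sq_fps_hauptmodul: "binom_sq_fps oo hauptmodul = theta3 ^ 2"
proof (rule dilate_equation_unique)
  define s where "s = landen_param"
  have s_nth_0: "s $ 0 = 0" by (simp add: s_def)
  have "binom_sq_fps oo hauptmodul = (binom_sq_fps oo (fps_X * inverse (1 + 4 * fps_X) ^ 2)) oo s"
    unfolding hauptmodul_eq_compose s_def by (rule fps_compose_assoc) simp_all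
  also have "\<dots> = (1 + 4 * s) * (dilate binom_sq_fps oo s)"
    unfolding binom_sq_fps_landen using s_nth_0
    by (simp add: fps_compose_mult_distrib fps_compose_add_distrib)
  also have "dilate binom_sq_fps oo s = dilate (binom_sq_fps oo hauptmodul)"
    by (simp add: compose_power2 [symmetric] dilate_compose dilate_hauptmodul s_def)
  finally show "(binom_sq_fps oo hauptmodul) ^ 1 * 1
      = (1 + 4 * landen_param) * dilate (binom_sq_fps oo hauptmodul)"
    by (simp add: s_def)
  show "(theta3 ^ 2) ^ 1 * 1 = (1 + 4 * landen_param) * dilate (theta3 ^ 2)"
    by (simp only: landen_param_theta3 power_one_right mult_1_right)
qed (simp_all add: fps_power_zeroth)

lemma log_derivative_hauptmodul_dilate:
  assumes "XD hauptmodul = L * hauptmodul"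
  shows "L * (1 + 4 * landen_param) = (1 - 4 * landen_param) * dilate L"
proof -
  define t where "t = hauptmodul"
  define s where "s = landen_param"
  have XD_t: "XD t = L * t" and dilate_t: "dilate t = s ^ 2" and t_s: "t * (1 + 4 * s) ^ 2 = s"
    unfolding t_def s_def by (rule assms dilate_hauptmodul hauptmodul_landen_param)+
  have "t \<noteq> 0" "dilate t \<noteq> 0"
    by (simp_all add: t_def)
  then have "s \<noteq> 0"
    using dilate_t by auto
  have "2 * s * XD s = 2 * s * (s * dilate L)"
    using XD_dilate [of t] unfolding dilate_t XD_t XD_square
    by (simp add: dilate_t power2_eq_square mult_ac)
  then have XD_s: "XD s = s * dilate L"
    using \<open>s \<noteq> 0\<close> by simp
  have "L * t * (1 + 4 * s) ^ 2 + t * (2 * (1 + 4 * s) * (4 * (s * dilate L))) = s * dilate L"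
    using arg_cong [OF t_s, of XD] by (simp add: XD_mult XD_square XD_t XD_s)
  then have "s * (L * (1 + 4 * s)) = s * ((1 - 4 * s) * dilate L)"
    using t_s by algebra
  then show ?thesis
    using \<open>s \<noteq> 0\<close> by (simp add: s_def)
qed

lemma XD_hauptmodul: "XD hauptmodul = theta4 ^ 4 * hauptmodul"
proof -
  define w where "w = hauptmodul_unit"
  define L where "L = 1 + XD w * inverse w"
  define A where "A = dilate (theta3 ^ 2)"
  have "w * inverse w = 1"
    by (intro inverse_mult_eq_1') (simp add: w_def)
  then have XD_t: "XD hauptmodul = L * hauptmodul"
    unfolding hauptmodul_def w_def [symmetric] L_def XD_mult XD_X by algebra
  have "L = theta4 ^ 4"
  proof (rule dilate_equation_unique)
    show "L ^ 1 * (1 + 4 * landen_param) = (1 - 4 * landen_param) * dilate L"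
      using log_derivative_hauptmodul_dilate [OF XD_t] by simp
    have "A * (theta4 ^ 4 * (1 + 4 * landen_param))
        = A * ((1 - 4 * landen_param) * (theta4 * theta3) ^ 2)"
      using landen_param_theta3 [folded A_def] landen_param_theta4 [folded A_def] by algebra
    moreover have "dilate (theta4 ^ 4) = (theta4 * theta3) ^ 2"
      by (simp add: theta4_mult_theta3 flip: power_mult)
    ultimately show "(theta4 ^ 4) ^ 1 * (1 + 4 * landen_param)
        = (1 - 4 * landen_param) * dilate (theta4 ^ 4)"
      by (simp add: A_def)
    show "1 + 4 * landen_param \<noteq> 0"
      using landen_param_theta3 by auto
  qed (simp_all add: L_def w_def fps_power_zeroth)
  with XD_t show ?thesis by simp
qed

lemma theta4_hauptmodul: "(1 - 16 * hauptmodul) * theta3 ^ 4 = theta4 ^ 4"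
  using hauptmodul_theta by (simp add: algebra_simps)

lemma eta_prod_eq_deriv_hauptmodul: "eta_prod = fps_deriv hauptmodul * theta3 ^ 8"
proof -
  have "fps_X * eta_prod = fps_X * (fps_deriv hauptmodul * theta3 ^ 8)"
    using XD_hauptmodul hauptmodul_eta unfolding XD_eq by algebra
  then show ?thesis by simp
qed

lemma XD_inverse_hauptmodul_unit:
  "XD (inverse hauptmodul_unit) = inverse hauptmodul_unit * (1 - theta4 ^ 4)"
proof -
  define v where "v = inverse hauptmodul_unit"
  have "hauptmodul * v = fps_X"
    by (simp add: hauptmodul_def v_def mult.assoc inverse_mult_eq_1')
  then have "XD (hauptmodul * v) = hauptmodul * v"
    by simp
  then have "hauptmodul * XD v = hauptmodul * (v * (1 - theta4 ^ 4))"
    unfolding XD_mult XD_hauptmodul by (simp add: algebra_simps)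
  then show ?thesis
    by (simp add: v_def)
qed

lemma XD_hauptmodul_quotient:
  "XD ((f oo hauptmodul) * inverse (theta3 ^ 2))
    = ((1 - 16 * fps_X) * (binom_sq_fps * XD f - f * XD binom_sq_fps)) oo hauptmodul"
proof -
  define a where "a = theta3 ^ 2"
  define i where "i = inverse a"
  have a_nth_0: "a $ 0 = 1"
    by (simp add: a_def fps_power_zeroth)
  then have ai: "a * i = 1"
    unfolding i_def by (intro inverse_mult_eq_1') simp
  have theta4: "theta4 ^ 4 = (1 - 16 * hauptmodul) * a ^ 2"
    using theta4_hauptmodul by (simp add: a_def flip: power_mult)
  have a_eq: "binom_sq_fps oo hauptmodul = a"
    by (simp add: a_def binom_sq_fps_hauptmodul)
  have XD_a: "XD a = theta4 ^ 4 * (XD binom_sq_fps oo hauptmodul)"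
    unfolding a_eq [symmetric] by (rule XD_compose [OF hauptmodul_nth_0 XD_hauptmodul])
  have "XD i = - XD a * i ^ 2"
    unfolding i_def by (rule XD_inverse) (simp add: a_nth_0)
  then have "XD ((f oo hauptmodul) * i)
      = (1 - 16 * hauptmodul) * (a * (XD f oo hauptmodul)
        - (f oo hauptmodul) * (XD binom_sq_fps oo hauptmodul))"
    unfolding XD_mult XD_compose [OF hauptmodul_nth_0 XD_hauptmodul] XD_a theta4 using ai by algebra
  also have "\<dots> = ((1 - 16 * fps_X) * (binom_sq_fps * XD f - f * XD binom_sq_fps)) oo hauptmodul"
    by (simp add: fps_compose_mult_distrib fps_compose_sub_distrib a_eq)
  finally show ?thesis
    by (simp add: i_def a_def)
qed

section \<open>Change of variables in a residue\<close>

lemma compose_mult_nth: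
  fixes f t g :: "'a::idom fps"
  assumes "t $ 0 = 0"
  shows "((f oo t) * g) $ n = (\<Sum>i=0..n. f $ i * (t ^ i * g) $ n)"
proof -
  have "(f oo t) $ j = (\<Sum>i=0..n. f $ i * t ^ i $ j)" if "j \<le> n" for j
    unfolding fps_compose_nth using that assms
    by (intro sum.mono_neutral_left) (auto simp: startsby_zero_power_prefix)
  then have "((f oo t) * g) $ n = (\<Sum>j=0..n. \<Sum>i=0..n. f $ i * (t ^ i $ j * g $ (n - j)))"
    by (simp add: fps_mult_nth sum_distrib_right mult.assoc)
  also have "\<dots> = (\<Sum>i=0..n. f $ i * (t ^ i * g) $ n)"
    by (subst sum.swap) (simp add: fps_mult_nth sum_distrib_left)
  finally show ?thesis .
qed

text \<open>Residues without negative powers: if \<open>t v = X\<close>, then the coefficient of \<open>X\<^sup>n\<close> in \<open>g v\<^sup>n\<^sup>+\<^sup>1\<close>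
  is the residue of \<open>g t\<^sup>-\<^sup>n\<^sup>-\<^sup>1\<close>.\<close>

lemma residue_power:
  fixes t v :: "'a::{idom, ring_char_0} fps"
  assumes tv: "t * v = fps_X" and "t $ 0 = 0"
  shows "(fps_deriv t * v ^ Suc n) $ n = (if n = 0 then 1 else 0)"
proof -
  have deriv_tv: "fps_deriv t * v + t * fps_deriv v = 1"
    using arg_cong [OF tv, of fps_deriv] by (simp add: mult.commute add.commute)
  show ?thesis
  proof (cases n)
    case 0
    then show ?thesis using arg_cong [OF deriv_tv, of "\<lambda>f. f $ 0"] assms(2) by simp
  next
    case (Suc m)
    have deriv_v2: "fps_deriv t * v ^ 2 = v - XD v"
      using deriv_tv tv unfolding XD_eq by algebra
    have "of_nat n * (fps_deriv t * v ^ Suc n) = of_nat n * ((fps_deriv t * v ^ 2) * v ^ m)"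
      by (simp add: Suc power2_eq_square mult_ac)
    also have "\<dots> = of_nat n * v ^ n - XD (v ^ n)"
      unfolding deriv_v2 XD_power by (simp add: Suc algebra_simps)
    finally have "(of_nat n * (fps_deriv t * v ^ Suc n)) $ n = (of_nat n * v ^ n - XD (v ^ n)) $ n"
      by simp
    then show ?thesis
      using Suc by (simp add: fps_of_nat [symmetric] del: of_nat_Suc)
  qed
qed

lemma residue_compose:
  fixes f t v :: "'a::{idom, ring_char_0} fps"
  assumes tv: "t * v = fps_X" and "t $ 0 = 0"
  shows "((f oo t) * (fps_deriv t * v ^ Suc n)) $ n = f $ n"
proof -
  have "(t ^ i * (fps_deriv t * v ^ Suc n)) $ n = (if i = n then 1 else 0)" if "i \<le> n" for i
  proof -
    have "v ^ Suc n = v ^ i * v ^ Suc (n - i)"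
      using that by (simp flip: power_add)
    then have "t ^ i * (fps_deriv t * v ^ Suc n) = (t * v) ^ i * (fps_deriv t * v ^ Suc (n - i))"
      by (simp only: power_mult_distrib mult_ac)
    then have "(t ^ i * (fps_deriv t * v ^ Suc n)) $ n = (fps_deriv t * v ^ Suc (n - i)) $ (n - i)"
      using that by (simp only: tv fps_X_power_mult_nth) simp
    then show ?thesis
      using that by (simp only: residue_power [OF assms]) auto
  qed
  then have "((f oo t) * (fps_deriv t * v ^ Suc n)) $ n = (\<Sum>i=0..n. if i = n then f $ i else 0)"
    unfolding compose_mult_nth [OF assms(2)] by (intro sum.cong) simp_all
  then show ?thesis by (simp del: power_Suc)
qed

section \<open>Congruences of integers\<close>

lemma coprime_int_prime_power:
  assumes "prime p" "\<not> p dvd n"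
  shows "coprime (int n ^ k) (int p ^ r)"
proof -
  have "coprime p n"
    using assms by (rule prime_imp_coprime)
  then have "coprime (int n) (int p)"
    by (simp add: coprime_commute)
  then show ?thesis
    by (simp add: coprime_power_left_iff coprime_power_right_iff)
qed

lemma odd_prime_not_dvd_power_2:
  fixes p :: nat
  assumes "prime p" "odd p"
  shows "\<not> p dvd 2 ^ n"
  using assms prime_dvd_power [of p 2 n] primes_dvd_imp_eq [of p 2] two_is_prime_nat by auto

lemma prime_not_dvd_central_binomial:
  assumes "prime p" "2 * n < p"
  shows "\<not> p dvd central_binomial n"
proof
  assume "p dvd central_binomial n"
  also have "central_binomial n dvd fact (2 * n)"
    using binomial_fact_lemma [of n "2 * n"] by (metis dvd_triv_right le_add1 mult_2)
  finally show False
    using assms by (simp add: prime_dvd_fact_iff)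
qed

lemma cong_recurrence_unique:
  fixes u v d s :: "nat \<Rightarrow> int"
  assumes "[u 0 = v 0] (mod m)"
    and "\<And>k. Suc k < N \<Longrightarrow> coprime (d k) m"
    and "\<And>k. Suc k < N \<Longrightarrow> [d k * u (Suc k) = s k * u k] (mod m)"
    and "\<And>k. Suc k < N \<Longrightarrow> [d k * v (Suc k) = s k * v k] (mod m)"
    and "k < N"
  shows "[u k = v k] (mod m)"
  using \<open>k < N\<close>
proof (induction k)
  case (Suc k)
  then have "[d k * u (Suc k) = s k * u k] (mod m)"
    using assms(3) by simp
  also have "[s k * u k = s k * v k] (mod m)"
    using Suc by (simp add: cong_scalar_left)
  also have "[s k * v k = d k * v (Suc k)] (mod m)"
    using assms(4) Suc.prems by (simp add: cong_sym_eq)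
  finally show ?case
    using assms(2) Suc.prems by (simp add: cong_mult_lcancel)
qed (use assms(1) in simp)

section \<open>Power series with integer coefficients\<close>

definition fps_Ints :: "'a::ring_1 fps set" where
  "fps_Ints = {f. \<forall>n. f $ n \<in> \<int>}"

lemma fps_IntsI: "(\<And>n. f $ n \<in> \<int>) \<Longrightarrow> f \<in> fps_Ints"
  by (simp add: fps_Ints_def)

lemma fps_Ints_nth: "f \<in> fps_Ints \<Longrightarrow> f $ n \<in> \<int>"
  by (simp add: fps_Ints_def)

lemma fps_Ints_1 [simp]: "1 \<in> fps_Ints"
  and fps_Ints_X [simp]: "fps_X \<in> fps_Ints"
  and fps_Ints_numeral [simp]: "numeral k \<in> fps_Ints"
  and fps_Ints_of_nat [simp]: "of_nat n \<in> fps_Ints"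
  by (simp_all add: fps_Ints_def fps_X_def fps_numeral_nth)

lemma fps_Ints_diff [simp]: "f \<in> fps_Ints \<Longrightarrow> g \<in> fps_Ints \<Longrightarrow> f - g \<in> fps_Ints"
  by (simp add: fps_Ints_def)

lemma fps_Ints_mult [simp]: "f \<in> fps_Ints \<Longrightarrow> g \<in> fps_Ints \<Longrightarrow> f * g \<in> fps_Ints"
  by (rule fps_IntsI) (unfold fps_mult_nth, intro Ints_sum Ints_mult fps_Ints_nth)

lemma fps_Ints_power [simp]: "f \<in> fps_Ints \<Longrightarrow> f ^ n \<in> fps_Ints"
  by (induction n) simp_all

lemma fps_Ints_compose [simp]: "f \<in> fps_Ints \<Longrightarrow> g \<in> fps_Ints \<Longrightarrow> f oo g \<in> fps_Ints"
  by (rule fps_IntsI) (unfold fps_compose_nth, intro Ints_sum Ints_mult fps_Ints_nth fps_Ints_power)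

lemma fps_Ints_deriv [simp]: "f \<in> fps_Ints \<Longrightarrow> fps_deriv f \<in> fps_Ints"
  by (rule fps_IntsI) (simp add: fps_Ints_nth del: of_nat_Suc)

lemma fps_Ints_XD [simp]: "f \<in> fps_Ints \<Longrightarrow> XD f \<in> fps_Ints"
  by (simp add: XD_eq)

lemma fps_Ints_inverse [simp]:
  fixes f :: "'a::field fps"
  assumes "f \<in> fps_Ints" "f $ 0 = 1"
  shows "inverse f \<in> fps_Ints"
proof (rule fps_IntsI)
  fix n show "inverse f $ n \<in> \<int>"
  proof (induction n rule: less_induct)
    case (less n)
    show ?case
    proof (cases "n = 0")
      case False
      then have "inverse f $ n = - (\<Sum>i=1..n. f $ i * inverse f $ (n - i))"
        using assms(2) by (cases n) (simp_all add: fps_inverse_def)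
      moreover have "(\<Sum>i=1..n. f $ i * inverse f $ (n - i)) \<in> \<int>"
        using less.IH fps_Ints_nth [OF assms(1)] by (intro Ints_sum Ints_mult) auto
      ultimately show ?thesis by simp
    qed (simp add: assms(2))
  qed
qed

lemma fps_Ints_theta [simp]: "theta3 \<in> fps_Ints" "theta4 \<in> fps_Ints"
  by (auto simp: fps_Ints_def theta3_def theta4_def square_series_def power_int_minus_left)

lemma fps_Ints_eta_prod [simp]: "eta_prod \<in> fps_Ints"
proof -
  have "euler_poly n \<in> fps_Ints" for n
    by (induction n) (simp_all add: euler_poly_Suc del: power_Suc)
  then have "euler \<in> fps_Ints"
    by (simp add: fps_Ints_def euler_def)
  then show ?thesis
    by (simp add: eta_prod_def dilate_def)
qed

lemma fps_Ints_hauptmodul [simp]: "hauptmodul_unit \<in> fps_Ints" "hauptmodul \<in> fps_Ints"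
  by (simp_all add: hauptmodul_def hauptmodul_unit_def fps_power_zeroth)

lemma fps_Ints_binom_sq_fps [simp]: "binom_sq_fps \<in> fps_Ints"
  by (simp add: fps_Ints_def binom_sq_fps_def)

section \<open>Congruences between the initial coefficients of power series\<close>

definition int_multiples :: "int \<Rightarrow> 'a::ring_1 set" where
  "int_multiples m = range (\<lambda>z. of_int (m * z))"

lemma of_int_in_int_multiples_iff:
  "(of_int z :: 'a::ring_char_0) \<in> int_multiples m \<longleftrightarrow> m dvd z"
  unfolding int_multiples_def image_iff of_int_eq_iff by (auto simp: dvd_def)

lemma int_multiples_self: "of_int m \<in> int_multiples m"
  unfolding int_multiples_def by (rule image_eqI [of _ _ 1]) simp_all

lemma int_multiples_0: "0 \<in> int_multiples m"
  unfolding int_multiples_def by (rule image_eqI [of _ _ 0]) simp_all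

lemma int_multiples_add: "x \<in> int_multiples m \<Longrightarrow> y \<in> int_multiples m \<Longrightarrow> x + y \<in> int_multiples m"
  unfolding int_multiples_def by (auto simp flip: of_int_add distrib_left)

lemma int_multiples_diff: "x \<in> int_multiples m \<Longrightarrow> y \<in> int_multiples m \<Longrightarrow> x - y \<in> int_multiples m"
  unfolding int_multiples_def by (auto simp flip: of_int_diff right_diff_distrib)

lemma int_multiples_mult:
  "x \<in> int_multiples l \<Longrightarrow> y \<in> int_multiples m \<Longrightarrow> x * y \<in> int_multiples (l * m)"
proof -
  assume "x \<in> int_multiples l" "y \<in> int_multiples m"
  then obtain a b where "x = of_int (l * a)" "y = of_int (m * b)"
    by (auto simp: int_multiples_def)
  then have "x * y = of_int (l * m * (a * b))"
    by (simp only: of_int_mult [symmetric] mult_ac)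
  then show ?thesis
    unfolding int_multiples_def by blast
qed

lemma int_multiples_1: "int_multiples 1 = \<int>"
  by (auto simp: int_multiples_def Ints_def)

lemma int_multiples_sum: "(\<And>i. i \<in> A \<Longrightarrow> f i \<in> int_multiples m) \<Longrightarrow> sum f A \<in> int_multiples m"
  by (induction A rule: infinite_finite_induct) (simp_all add: int_multiples_0 int_multiples_add)

definition fps_cong :: "int \<Rightarrow> nat \<Rightarrow> 'a::comm_ring_1 fps \<Rightarrow> 'a fps \<Rightarrow> bool" where
  "fps_cong m N f g \<longleftrightarrow> (\<forall>n<N. f $ n - g $ n \<in> int_multiples m)"

lemma fps_cong_nth: "fps_cong m N f g \<Longrightarrow> n < N \<Longrightarrow> f $ n - g $ n \<in> int_multiples m"
  by (simp add: fps_cong_def)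

lemma fps_cong_refl: "fps_cong m N f f"
  by (simp add: fps_cong_def int_multiples_0)

lemma fps_cong_trans [trans]: "fps_cong m N f g \<Longrightarrow> fps_cong m N g h \<Longrightarrow> fps_cong m N f h"
  unfolding fps_cong_def using int_multiples_add by fastforce

lemma fps_cong_add: "fps_cong m N f f' \<Longrightarrow> fps_cong m N g g' \<Longrightarrow> fps_cong m N (f + g) (f' + g')"
  unfolding fps_cong_def fps_add_nth add_diff_add by (simp add: int_multiples_add)

lemma fps_cong_diff: "fps_cong m N f f' \<Longrightarrow> fps_cong m N g g' \<Longrightarrow> fps_cong m N (f - g) (f' - g')"
  unfolding fps_cong_def fps_sub_nth diff_diff_eq2
  using int_multiples_diff by (fastforce simp: algebra_simps)

lemma fps_cong_mult_left:
  assumes "h \<in> fps_Ints" "fps_cong m N f g"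
  shows "fps_cong m N (h * f) (h * g)"
  unfolding fps_cong_def
proof (intro allI impI)
  fix n assume "n < N"
  then have "h $ i * (f - g) $ (n - i) \<in> int_multiples (1 * m)" for i
    using assms by (intro int_multiples_mult) (auto simp: int_multiples_1 fps_Ints_nth fps_cong_def)
  then have "(h * (f - g)) $ n \<in> int_multiples m"
    unfolding fps_mult_nth by (intro int_multiples_sum) simp
  then show "(h * f) $ n - (h * g) $ n \<in> int_multiples m"
    by (simp add: right_diff_distrib)
qed

lemma fps_cong_scale: "fps_cong l N f g \<Longrightarrow> fps_cong (m * l) N (of_int m * f) (of_int m * g)"
  unfolding fps_cong_def fps_mult_of_int_nth right_diff_distrib [symmetric]
  by (simp add: int_multiples_mult int_multiples_self)

lemma fps_cong_of_int_mult_0: "f \<in> fps_Ints \<Longrightarrow> fps_cong m N (of_int m * f) 0"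
  using fps_cong_scale [of 1 N f 0 m] by (simp add: fps_cong_def fps_Ints_nth int_multiples_1)

lemma fps_cong_mult:
  assumes "fps_cong m N f f'" "fps_cong m N g g'" "f \<in> fps_Ints" "g' \<in> fps_Ints"
  shows "fps_cong m N (f * g) (f' * g')"
proof -
  have "fps_cong m N (f * g) (f * g')"
    using assms by (intro fps_cong_mult_left)
  moreover have "fps_cong m N (g' * f) (g' * f')"
    using assms by (intro fps_cong_mult_left)
  ultimately show ?thesis
    by (metis fps_cong_trans mult.commute)
qed

lemma fps_cong_compose:
  assumes "fps_cong m N f g" "t \<in> fps_Ints"
  shows "fps_cong m N (f oo t) (g oo t)"
  unfolding fps_cong_def
proof (intro allI impI)
  fix n assume "n < N"
  then have "(f - g) $ i * t ^ i $ n \<in> int_multiples (m * 1)" if "i \<le> n" for i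
    using that assms
    by (intro int_multiples_mult) (auto simp: int_multiples_1 fps_Ints_nth fps_cong_def)
  then have "((f - g) oo t) $ n \<in> int_multiples m"
    unfolding fps_compose_nth by (intro int_multiples_sum) simp
  then show "(f oo t) $ n - (g oo t) $ n \<in> int_multiples m"
    by (simp add: fps_compose_sub_distrib)
qed

lemma fps_cong_XD:
  assumes "fps_cong m N f g"
  shows "fps_cong m N (XD f) (XD g)"
  unfolding fps_cong_def
proof (intro allI impI)
  fix n assume "n < N"
  then have "of_nat n * (f $ n - g $ n) \<in> int_multiples (1 * m)"
    using assms by (intro int_multiples_mult) (auto simp: int_multiples_1 fps_cong_def)
  then show "XD f $ n - XD g $ n \<in> int_multiples m"
    by (simp add: right_diff_distrib)
qed

lemma fps_cong_XD_cancel: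
  fixes f g :: "'a::{comm_ring_1, ring_char_0} fps"
  assumes "prime p" "f \<in> fps_Ints" "g \<in> fps_Ints" "f $ 0 = g $ 0"
    and cong: "fps_cong (int p ^ k) p (XD f) (XD g)"
  shows "fps_cong (int p ^ k) p f g"
  unfolding fps_cong_def
proof (intro allI impI)
  fix n assume "n < p"
  show "f $ n - g $ n \<in> int_multiples (int p ^ k)"
  proof (cases "n = 0")
    case False
    obtain z where z: "f $ n - g $ n = of_int z"
      using assms(2,3) by (meson Ints_cases Ints_diff fps_Ints_nth)
    have "of_int (int n * z) \<in> (int_multiples (int p ^ k) :: 'a set)"
      using cong \<open>n < p\<close> by (auto simp: fps_cong_def right_diff_distrib simp flip: z)
    then have "int p ^ k dvd int n * z"
      by (simp only: of_int_in_int_multiples_iff)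
    moreover have "coprime (int n ^ 1) (int p ^ k)"
      using False \<open>n < p\<close> by (intro coprime_int_prime_power \<open>prime p\<close>) (simp add: nat_dvd_not_less)
    ultimately have "int p ^ k dvd z"
      by (simp add: coprime_commute coprime_dvd_mult_right_iff)
    then show ?thesis
      by (simp only: z of_int_in_int_multiples_iff)
  qed (simp add: assms(4) int_multiples_0)
qed

section \<open>Shifted Legendre polynomials\<close>

lemma binom_term_Suc:
  "int (Suc k) ^ 2 * binom_term h (Suc k) = (int h - int k) * (int h + int k + 1) * binom_term h k"
proof (cases "k \<le> h")
  case True
  have "Suc k * (h choose Suc k) = (h - k) * (h choose k)"
    by (metis binomial_absorb_comp binomial_absorption)
  moreover have "Suc k * (h + Suc k choose Suc k) = Suc (h + k) * (h + k choose k)"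
    using Suc_times_binomial [of k "h + k"] by simp
  ultimately have "(Suc k * (h choose Suc k)) * (Suc k * (h + Suc k choose Suc k))
      = (h - k) * (h choose k) * (Suc (h + k) * (h + k choose k))"
    by simp
  then have "Suc k ^ 2 * ((h choose Suc k) * (h + Suc k choose Suc k))
      = (h - k) * (h + k + 1) * ((h choose k) * (h + k choose k))"
    by (simp only: power2_eq_square mult_ac Suc_eq_plus1)
  then have "int (Suc k ^ 2 * ((h choose Suc k) * (h + Suc k choose Suc k)))
      = int ((h - k) * (h + k + 1) * ((h choose k) * (h + k choose k)))"
    by (simp only:)
  then show ?thesis
    unfolding binom_term_def using True
    by (simp only: of_nat_mult of_nat_power of_nat_diff of_nat_add of_nat_1)
qed (simp add: binom_term_def binomial_eq_0)

text \<open>The coefficients of the Legendre polynomial \<open>P\<^sub>h(1 - 32x)\<close> and of its reversal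
  \<open>(-16x)\<^sup>h P\<^sub>h(1 - 1/(8x))\<close>.\<close>

definition legendre_coeff :: "nat \<Rightarrow> nat \<Rightarrow> int" where
  "legendre_coeff h k = (-16) ^ k * binom_term h k"

definition legendre_rev_coeff :: "nat \<Rightarrow> nat \<Rightarrow> int" where
  "legendre_rev_coeff h k = (if k \<le> h then (-16) ^ k * binom_term h (h - k) else 0)"

lemma legendre_coeff_Suc:
  "int (Suc k) ^ 2 * legendre_coeff h (Suc k)
    = 4 * ((2 * int k + 1) ^ 2 - (2 * int h + 1) ^ 2) * legendre_coeff h k"
proof -
  have "int (Suc k) ^ 2 * legendre_coeff h (Suc k)
      = (-16) ^ Suc k * (int (Suc k) ^ 2 * binom_term h (Suc k))"
    by (simp add: legendre_coeff_def)
  then show ?thesis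
    unfolding binom_term_Suc by (simp add: legendre_coeff_def power2_eq_square algebra_simps)
qed

lemma legendre_rev_coeff_Suc:
  "int (Suc k) * (int k - 2 * int h) * legendre_rev_coeff h (Suc k)
    = 16 * (int h - int k) ^ 2 * legendre_rev_coeff h k"
proof (cases "k < h")
  case True
  then obtain n where h: "h = k + Suc n"
    using less_imp_Suc_add by fastforce
  have "int (Suc k) * (int k - 2 * int h) * legendre_rev_coeff h (Suc k)
      = 16 * (-16) ^ k * ((int h - int n) * (int h + int n + 1) * binom_term h n)"
    by (simp add: h legendre_rev_coeff_def algebra_simps)
  also have "\<dots> = 16 * (-16) ^ k * (int (Suc n) ^ 2 * binom_term h (Suc n))"
    by (simp only: binom_term_Suc)
  finally show ?thesis
    by (simp add: h legendre_rev_coeff_def algebra_simps)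
qed (auto simp: legendre_rev_coeff_def)

lemma legendre_rev_coeff_0: "legendre_rev_coeff h 0 = int (central_binomial h)"
  by (simp add: legendre_rev_coeff_def binom_term_def mult_2)

definition legendre_fps :: "nat \<Rightarrow> rat fps" where
  "legendre_fps h = Abs_fps (\<lambda>k. of_int (legendre_coeff h k))"

definition legendre_rev_fps :: "nat \<Rightarrow> rat fps" where
  "legendre_rev_fps h = Abs_fps (\<lambda>k. of_int (legendre_rev_coeff h k))"

lemma fps_Ints_legendre_fps [simp]: "legendre_fps h \<in> fps_Ints" "legendre_rev_fps h \<in> fps_Ints"
  by (simp_all add: fps_Ints_def legendre_fps_def legendre_rev_fps_def)

lemma legendre_rev_fps_nth_0 [simp]: "legendre_rev_fps h $ 0 = of_nat (central_binomial h)"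
  by (simp add: legendre_rev_fps_def legendre_rev_coeff_0)

lemma legendre_rev_fps_ode:
  fixes h :: nat
  defines "p \<equiv> of_nat (2 * h + 1)" and "Y \<equiv> legendre_rev_fps h"
  shows "XD ((1 - 16 * fps_X) * XD Y)
    = 4 * fps_X * Y + p * ((1 - 16 * fps_X) * XD Y - 8 * fps_X * Y) + p ^ 2 * (4 * fps_X * Y)"
    (is "?l = ?r")
proof (rule fps_ext)
  fix n show "?l $ n = ?r $ n"
  proof (cases n)
    case 0
    then show ?thesis
      by (simp add: p_def mult.assoc)
  next
    case (Suc k)
    define y0 where "y0 = Y $ k"
    define y1 where "y1 = Y $ Suc k"
    have "rat_of_int (int (Suc k) * (int k - 2 * int h) * legendre_rev_coeff h (Suc k))
        = of_int (16 * (int h - int k) ^ 2 * legendre_rev_coeff h k)"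
      by (simp only: legendre_rev_coeff_Suc)
    then have "(of_nat k + 1) * (of_nat k - 2 * of_nat h) * y1
        = 16 * (of_nat h - of_nat k) ^ 2 * y0"
      by (simp add: y0_def y1_def Y_def legendre_rev_fps_def add.commute)
    moreover have p_mult_nth: "(p * f) $ n = (2 * of_nat h + 1) * f $ n" for f n
      unfolding p_def fps_mult_of_nat_nth by simp
    ultimately show ?thesis
      unfolding Suc fps_XD_nth left_diff_distrib right_diff_distrib mult_1_left power2_eq_square
        mult.assoc [of p p] fps_add_nth fps_sub_nth p_mult_nth numeral_X_mult_nth_Suc
        y0_def [symmetric] y1_def [symmetric]
      by (simp add: algebra_simps)
  qed
qed

lemma fps_eq_sum_monomials:
  fixes f :: "'a::comm_ring_1 fps"
  assumes "\<And>k. k > n \<Longrightarrow> f $ k = 0"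
  shows "f = (\<Sum>k\<le>n. fps_const (f $ k) * fps_X ^ k)"
  using assms by (auto simp: fps_eq_iff fps_sum_nth fps_X_power_nth if_distrib cong: if_cong)

definition legendre_monom :: "nat \<Rightarrow> int \<Rightarrow> rat fps" where
  "legendre_monom k c = fps_const (of_int ((-16) ^ k * c)) * fps_X ^ k"

lemma legendre_monom_mult:
  "legendre_monom i a * legendre_monom j b = legendre_monom (i + j) (a * b)"
  by (simp add: legendre_monom_def power_add mult_ac flip: fps_const_mult)

lemma legendre_monom_nth_even:
  "legendre_monom n c $ (2 * h) = of_int (256 ^ h * (if n = 2 * h then c else 0))"
proof (cases "n = 2 * h")
  case True
  have "(-16 :: int) ^ (2 * h) = 256 ^ h"
    by (simp add: power_mult)
  then show ?thesis
    by (simp only: True legendre_monom_def fps_mult_left_const_nth fps_X_power_nth if_True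
        simp_thms mult_1_right)
qed (simp add: legendre_monom_def fps_X_power_nth)

lemma legendre_fps_eq_sum: "legendre_fps h = (\<Sum>k\<le>h. legendre_monom k (binom_term h k))"
  by (subst fps_eq_sum_monomials [of h "legendre_fps h"])
    (simp_all add: legendre_fps_def legendre_coeff_def legendre_monom_def binom_term_def)

lemma legendre_rev_fps_eq_sum:
  "legendre_rev_fps h = (\<Sum>k\<le>h. legendre_monom (h - k) (binom_term h k))"
proof -
  have "legendre_rev_fps h = (\<Sum>k\<le>h. legendre_monom k (binom_term h (h - k)))"
    by (subst fps_eq_sum_monomials [of h "legendre_rev_fps h"])
      (simp_all add: legendre_rev_fps_def legendre_rev_coeff_def legendre_monom_def)
  also have "\<dots> = (\<Sum>k\<le>h. legendre_monom (h - k) (binom_term h k))"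
    by (rule sum.reindex_bij_witness [of _ "\<lambda>k. h - k" "\<lambda>k. h - k"]) auto
  finally show ?thesis .
qed

definition binom_term_convolution :: "nat \<Rightarrow> int" where
  "binom_term_convolution h = (\<Sum>k1\<le>h. \<Sum>k2\<le>h. \<Sum>k3\<le>h. \<Sum>k4\<le>h.
     if k1 + k2 = k3 + k4
     then binom_term h k1 * binom_term h k2 * binom_term h k3 * binom_term h k4 else 0)"

lemma legendre_fps_product_nth:
  "(legendre_fps h ^ 2 * legendre_rev_fps h ^ 2) $ (2 * h)
    = of_int (256 ^ h * binom_term_convolution h)"
proof -
  define a where "a = binom_term h"
  define L where "L = (\<Sum>k\<le>h. legendre_monom k (a k))"
  define R where "R = (\<Sum>k\<le>h. legendre_monom (h - k) (a k))"
  have "L * (L * (R * R)) = (\<Sum>k1\<le>h. \<Sum>k2\<le>h. \<Sum>k3\<le>h. \<Sum>k4\<le>h.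
      legendre_monom (k1 + k2 + (h - k3) + (h - k4)) (a k1 * a k2 * a k3 * a k4))"
    unfolding L_def R_def
    by (simp only: sum_product)
      (simp only: sum_distrib_left legendre_monom_mult add.assoc mult.assoc)
  then have "(L * (L * (R * R))) $ (2 * h) = of_int (256 ^ h * (\<Sum>k1\<le>h. \<Sum>k2\<le>h. \<Sum>k3\<le>h. \<Sum>k4\<le>h.
      if k1 + k2 + (h - k3) + (h - k4) = 2 * h then a k1 * a k2 * a k3 * a k4 else 0))"
    by (simp only: fps_sum_nth legendre_monom_nth_even sum_distrib_left of_int_sum)
  also have "(\<Sum>k1\<le>h. \<Sum>k2\<le>h. \<Sum>k3\<le>h. \<Sum>k4\<le>h.
      if k1 + k2 + (h - k3) + (h - k4) = 2 * h then a k1 * a k2 * a k3 * a k4 else 0)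
    = binom_term_convolution h"
    unfolding binom_term_convolution_def a_def by (intro sum.cong refl if_cong) auto
  finally show ?thesis
    by (simp only: L_def R_def a_def legendre_fps_eq_sum legendre_rev_fps_eq_sum power2_eq_square
        mult.assoc)
qed

section \<open>Congruences modulo the square of a prime\<close>

definition legendre_quotient :: "nat \<Rightarrow> rat fps" where
  "legendre_quotient h = (legendre_rev_fps h oo hauptmodul) * inverse (theta3 ^ 2)"

lemma fps_Ints_legendre_quotient [simp]: "legendre_quotient h \<in> fps_Ints"
  by (simp add: legendre_quotient_def fps_power_zeroth)

lemma legendre_quotient_nth_0 [simp]: "legendre_quotient h $ 0 = of_nat (central_binomial h)"
  by (simp add: legendre_quotient_def fps_power_zeroth)

lemma legendre_quotient_mult_theta3:
  "legendre_quotient h * theta3 ^ 2 = legendre_rev_fps h oo hauptmodul"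
  by (simp add: legendre_quotient_def mult.assoc inverse_mult_eq_1 fps_power_zeroth)

context
  fixes p h :: nat
  assumes prime_p: "prime p" and p_eq: "p = 2 * h + 1"
begin

lemma cong_central_binomial_square:
  fixes u :: "nat \<Rightarrow> int"
  assumes rec: "\<And>k. [int (Suc k) ^ 2 * u (Suc k) = 4 * (2 * int k + 1) ^ 2 * u k] (mod int p ^ r)"
    and "k < p"
  shows "[u k = u 0 * int (central_binomial k ^ 2)] (mod int p ^ r)"
proof (rule cong_recurrence_unique [OF _ _ _ _ \<open>k < p\<close>])
  fix k assume "Suc k < p"
  then show "coprime (int (Suc k) ^ 2) (int p ^ r)"
    using prime_p by (intro coprime_int_prime_power) (simp_all add: nat_dvd_not_less)
  show "[int (Suc k) ^ 2 * u (Suc k) = 4 * (2 * int k + 1) ^ 2 * u k] (mod int p ^ r)"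
    by (rule rec)
  have "int (Suc k ^ 2 * central_binomial (Suc k) ^ 2)
      = int (4 * (2 * k + 1) ^ 2 * central_binomial k ^ 2)"
    by (simp only: central_binomial_square_Suc)
  then have "int (Suc k) ^ 2 * int (central_binomial (Suc k) ^ 2)
      = 4 * (2 * int k + 1) ^ 2 * int (central_binomial k ^ 2)"
    by (simp only: of_nat_mult of_nat_power of_nat_add of_nat_numeral of_nat_1)
  then show "[int (Suc k) ^ 2 * (u 0 * int (central_binomial (Suc k) ^ 2))
      = 4 * (2 * int k + 1) ^ 2 * (u 0 * int (central_binomial k ^ 2))] (mod int p ^ r)"
    by (simp only: mult.left_commute [of _ "u 0"] cong_refl)
qed simp

lemma legendre_coeff_cong:
  assumes "k < p"
  shows "[legendre_coeff h k = int (central_binomial k ^ 2)] (mod int p ^ 2)"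
proof -
  have "int (Suc k) ^ 2 * legendre_coeff h (Suc k) - 4 * (2 * int k + 1) ^ 2 * legendre_coeff h k
      = int p ^ 2 * (- 4 * legendre_coeff h k)" for k
    unfolding legendre_coeff_Suc by (simp add: p_eq algebra_simps)
  then have "[legendre_coeff h k = legendre_coeff h 0 * int (central_binomial k ^ 2)]
      (mod int p ^ 2)"
    using assms
    by (intro cong_central_binomial_square) (simp_all only: cong_iff_dvd_diff dvd_triv_left)
  then show ?thesis
    by (simp add: legendre_coeff_def binom_term_def)
qed

lemma legendre_rev_coeff_cong:
  assumes "k < p"
  shows "[legendre_rev_coeff h k = int (central_binomial h) * int (central_binomial k ^ 2)]
    (mod int p)"
proof -
  have "int (Suc k) ^ 2 * legendre_rev_coeff h (Suc k)
        - 4 * (2 * int k + 1) ^ 2 * legendre_rev_coeff h k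
      = int p ^ 1 * (int (Suc k) * legendre_rev_coeff h (Suc k)
        + 4 * (int p - 4 * int k - 2) * legendre_rev_coeff h k)" for k
    using legendre_rev_coeff_Suc [of k h] by (simp add: p_eq power2_eq_square algebra_simps)
  then have "[legendre_rev_coeff h k = legendre_rev_coeff h 0 * int (central_binomial k ^ 2)]
      (mod int p ^ 1)"
    using assms
    by (intro cong_central_binomial_square) (simp_all only: cong_iff_dvd_diff dvd_triv_left)
  then show ?thesis
    by (simp only: legendre_rev_coeff_0 power_one_right)
qed

lemma central_binomial_square_cong: "[int (central_binomial h) ^ 2 = 256 ^ h] (mod int p ^ 2)"
proof -
  define B where "B = int (central_binomial h)"
  have "\<not> p dvd central_binomial h"
    using prime_p by (rule prime_not_dvd_central_binomial) (simp add: p_eq)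
  then have "coprime B (int p ^ 2)"
    using coprime_int_prime_power [OF prime_p, of _ 1 2] by (simp add: B_def)
  moreover have "legendre_coeff h h = (-16) ^ h * B"
    by (simp add: legendre_coeff_def binom_term_def B_def mult_2)
  then have "[B * (-16) ^ h = B * B] (mod int p ^ 2)"
    using legendre_coeff_cong [of h] by (simp add: p_eq B_def power2_eq_square mult.commute)
  ultimately have "[(-16) ^ h = B] (mod int p ^ 2)"
    by (simp only: cong_mult_lcancel)
  then have "[((-16) ^ h) ^ 2 = B ^ 2] (mod int p ^ 2)"
    by (rule cong_pow)
  moreover have "((-16) ^ h) ^ 2 = (256 ^ h :: int)"
    by (simp add: power_mult [symmetric] mult.commute [of h]) (simp add: power_mult)
  ultimately show ?thesis
    by (simp add: B_def cong_sym_eq)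
qed

lemma legendre_fps_cong: "fps_cong (int p ^ 2) p (legendre_fps h) binom_sq_fps"
  unfolding fps_cong_def
proof (intro allI impI)
  fix n assume "n < p"
  then have "int p ^ 2 dvd legendre_coeff h n - int (central_binomial n ^ 2)"
    using legendre_coeff_cong by (simp only: cong_iff_dvd_diff)
  then have "rat_of_int (legendre_coeff h n - int (central_binomial n ^ 2))
      \<in> int_multiples (int p ^ 2)"
    by (simp only: of_int_in_int_multiples_iff)
  then show "legendre_fps h $ n - binom_sq_fps $ n \<in> int_multiples (int p ^ 2)"
    by (simp add: binom_sq_fps_def legendre_fps_def)
qed

lemma legendre_rev_fps_cong:
  "fps_cong (int p) p (legendre_rev_fps h) (of_nat (central_binomial h) * binom_sq_fps)"
  unfolding fps_cong_def
proof (intro allI impI)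
  fix n assume "n < p"
  then have "int p dvd
      legendre_rev_coeff h n - int (central_binomial h) * int (central_binomial n ^ 2)"
    using legendre_rev_coeff_cong by (simp only: cong_iff_dvd_diff)
  then have "rat_of_int
      (legendre_rev_coeff h n - int (central_binomial h) * int (central_binomial n ^ 2))
      \<in> int_multiples (int p)"
    by (simp only: of_int_in_int_multiples_iff)
  then show "legendre_rev_fps h $ n - (of_nat (central_binomial h) * binom_sq_fps) $ n
      \<in> int_multiples (int p)"
    by (simp add: binom_sq_fps_def legendre_rev_fps_def)
qed

lemma wronskian_cong:
  defines "B \<equiv> of_nat (central_binomial h)" and "F \<equiv> binom_sq_fps" and "Y \<equiv> legendre_rev_fps h"
  shows "fps_cong (int p ^ 2) p (2 * ((1 - 16 * fps_X) * (F * XD Y - Y * XD F)))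
    (of_nat p * (B * ((1 - 16 * fps_X) * F ^ 2 - 1)))"
    (is "fps_cong _ _ (2 * ?V) (of_nat p * ?R)")
proof (rule fps_cong_XD_cancel [OF prime_p])
  define A :: "rat fps" where "A = 1 - 16 * fps_X"
  define P :: "rat fps" where "P = of_int (int p)"
  have "XD (2 * ?V) = 2 * (F * XD (A * XD Y) - Y * XD (A * XD F))"
    by (simp add: A_def XD_mult [of 2] XD_wronskian)
  also have "\<dots> = P * (2 * F * (A * XD Y - 8 * fps_X * Y + P * (4 * fps_X * Y)))"
    unfolding A_def F_def Y_def binom_sq_fps_ode legendre_rev_fps_ode
    by (simp add: P_def p_eq power2_eq_square algebra_simps)
  finally have XD_V: "XD (2 * ?V)
      = P * (2 * F * (A * XD Y - 8 * fps_X * Y + P * (4 * fps_X * Y)))" .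
  have XD_R: "XD (of_nat p * ?R) = P * (2 * F * (A * XD (B * F) - 8 * fps_X * (B * F) + 0))"
    by (simp add: A_def B_def P_def XD_mult XD_square power2_eq_square algebra_simps)
  have "fps_cong (int p) p Y (B * F)"
    unfolding Y_def B_def F_def by (rule legendre_rev_fps_cong)
  moreover have "fps_cong (int p) p (P * (4 * fps_X * Y)) 0"
    unfolding P_def by (rule fps_cong_of_int_mult_0) (simp add: Y_def)
  ultimately have "fps_cong (int p * int p) p (XD (2 * ?V)) (XD (of_nat p * ?R))"
    unfolding XD_V XD_R unfolding P_def
    by (intro fps_cong_scale fps_cong_mult_left fps_cong_add fps_cong_diff fps_cong_XD)
      (simp_all add: A_def F_def)
  then show "fps_cong (int p ^ 2) p (XD (2 * ?V)) (XD (of_nat p * ?R))"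
    by (simp only: power2_eq_square)
qed (simp_all add: F_def Y_def B_def fps_power_zeroth)

lemma legendre_quotient_cong:
  "fps_cong (int p) p (legendre_quotient h) (of_nat (central_binomial h))"
proof -
  define a where "a = theta3 ^ 2"
  have a_inverse: "inverse a * a = 1"
    by (intro inverse_mult_eq_1) (simp add: a_def fps_power_zeroth)
  have "fps_cong (int p) p (inverse a * (legendre_rev_fps h oo hauptmodul))
      (inverse a * ((of_nat (central_binomial h) * binom_sq_fps) oo hauptmodul))"
    by (intro fps_cong_mult_left fps_cong_compose legendre_rev_fps_cong)
      (simp_all add: a_def fps_power_zeroth)
  also have "(of_nat (central_binomial h) * binom_sq_fps) oo hauptmodul
      = of_nat (central_binomial h) * a"
    by (simp add: fps_compose_mult_distrib binom_sq_fps_hauptmodul a_def flip: fps_of_nat)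
  also have "inverse a * (of_nat (central_binomial h) * a) = of_nat (central_binomial h)"
    using a_inverse by (simp add: mult.left_commute)
  finally show ?thesis
    by (simp add: legendre_quotient_def a_def mult.commute)
qed

lemma XD_legendre_quotient_cong:
  "fps_cong (int p ^ 2) p (2 * XD (legendre_quotient h))
    (of_nat p * (of_nat (central_binomial h) * (theta4 ^ 4 - 1)))"
proof -
  have "fps_cong (int p ^ 2) p (2 * XD (legendre_quotient h))
      ((of_nat p * (of_nat (central_binomial h) * ((1 - 16 * fps_X) * binom_sq_fps ^ 2 - 1)))
        oo hauptmodul)"
    using fps_cong_compose [OF wronskian_cong fps_Ints_hauptmodul(2)]
    by (simp add: legendre_quotient_def XD_hauptmodul_quotient fps_compose_mult_distrib)
  also have "\<dots>
      = of_nat p * (of_nat (central_binomial h) * ((1 - 16 * hauptmodul) * theta3 ^ 4 - 1))"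
    by (simp add: fps_compose_mult_distrib fps_compose_sub_distrib fps_compose_power [symmetric]
        binom_sq_fps_hauptmodul flip: fps_of_nat power_mult)
  finally show ?thesis
    by (simp only: theta4_hauptmodul)
qed

lemma legendre_quotient_square_cong:
  "fps_cong (int p ^ 2) p (legendre_quotient h ^ 2 * inverse hauptmodul_unit ^ p)
    (of_nat (central_binomial h) ^ 2)"
proof (rule fps_cong_XD_cancel [OF prime_p])
  define W where "W = legendre_quotient h"
  define v where "v = inverse hauptmodul_unit"
  define B :: "rat fps" where "B = of_nat (central_binomial h)"
  define L where "L = theta4 ^ 4 - 1"
  have "XD (v ^ p) = - (of_nat p * L * v ^ p)"
    unfolding XD_power v_def XD_inverse_hauptmodul_unit using p_eq
    by (simp add: L_def algebra_simps)
  then have XD_lhs: "XD (W ^ 2 * v ^ p) = W * v ^ p * (2 * XD W - of_int (int p) * (L * W))"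
    by (simp add: XD_mult XD_square power2_eq_square algebra_simps)
  have "fps_cong (int p * int p) p (of_int (int p) * (L * W)) (of_int (int p) * (L * B))"
    unfolding W_def B_def
    by (intro fps_cong_scale fps_cong_mult_left legendre_quotient_cong) (simp add: L_def)
  moreover have "fps_cong (int p * int p) p (2 * XD W) (of_int (int p) * (L * B))"
    using XD_legendre_quotient_cong by (simp add: W_def B_def L_def power2_eq_square mult.commute)
  ultimately have "fps_cong (int p * int p) p (W * v ^ p * (2 * XD W - of_int (int p) * (L * W)))
      (W * v ^ p * (of_int (int p) * (L * B) - of_int (int p) * (L * B)))"
    by (intro fps_cong_mult_left [of "W * v ^ p"] fps_cong_diff) (simp_all add: W_def v_def)
  then have "fps_cong (int p ^ 2) p (XD (W ^ 2 * v ^ p)) (XD (B ^ 2))"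
    unfolding XD_lhs by (simp add: B_def XD_square power2_eq_square [of "int p"])
  then show "fps_cong (int p ^ 2) p (XD (legendre_quotient h ^ 2 * inverse hauptmodul_unit ^ p))
      (XD (of_nat (central_binomial h) ^ 2))"
    by (simp only: W_def v_def B_def)
qed (simp_all add: fps_power_zeroth)

lemma eta_prod_cong:
  "fps_cong (int p ^ 2) p
    (((binom_sq_fps ^ 2 * legendre_rev_fps h ^ 2) oo hauptmodul)
      * (fps_deriv hauptmodul * inverse hauptmodul_unit ^ p))
    (of_nat (central_binomial h) ^ 2 * eta_prod)"
proof -
  have "((binom_sq_fps ^ 2 * legendre_rev_fps h ^ 2) oo hauptmodul)
      = (theta3 ^ 2) ^ 2 * (legendre_quotient h * theta3 ^ 2) ^ 2"
    by (simp only: fps_compose_mult_distrib fps_compose_power [symmetric] hauptmodul_nth_0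
        binom_sq_fps_hauptmodul legendre_quotient_mult_theta3)
  also have "\<dots> = theta3 ^ 8 * legendre_quotient h ^ 2"
    by (simp add: power_mult_distrib mult_ac flip: power_mult power_add)
  finally have "((binom_sq_fps ^ 2 * legendre_rev_fps h ^ 2) oo hauptmodul)
      * (fps_deriv hauptmodul * inverse hauptmodul_unit ^ p)
      = eta_prod * (legendre_quotient h ^ 2 * inverse hauptmodul_unit ^ p)"
    by (simp only: eta_prod_eq_deriv_hauptmodul mult_ac)
  then show ?thesis
    by (simp only: mult.commute [of _ eta_prod] fps_cong_mult_left fps_Ints_eta_prod
        legendre_quotient_square_cong)
qed

lemma legendre_product_nth_cong:
  "(legendre_fps h ^ 2 * legendre_rev_fps h ^ 2) $ (2 * h)
    - (of_nat (central_binomial h) ^ 2 * eta_prod) $ (2 * h) \<in> int_multiples (int p ^ 2)"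
proof -
  define G where "G = binom_sq_fps ^ 2 * legendre_rev_fps h ^ 2"
  define v where "v = inverse hauptmodul_unit"
  have "hauptmodul * v = fps_X"
    by (simp add: hauptmodul_def v_def mult.assoc inverse_mult_eq_1')
  then have residue: "((G oo hauptmodul) * (fps_deriv hauptmodul * v ^ p)) $ (2 * h) = G $ (2 * h)"
    using residue_compose [of hauptmodul v G "2 * h"] by (simp add: p_eq)
  have "fps_cong (int p ^ 2) p (legendre_fps h ^ 2 * legendre_rev_fps h ^ 2) G"
    unfolding G_def power2_eq_square [of "_ :: rat fps"]
    by (intro fps_cong_mult fps_cong_refl legendre_fps_cong) simp_all
  then have "(legendre_fps h ^ 2 * legendre_rev_fps h ^ 2) $ (2 * h) - G $ (2 * h)
      \<in> int_multiples (int p ^ 2)"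
    by (rule fps_cong_nth) (simp add: p_eq)
  moreover have "G $ (2 * h) - (of_nat (central_binomial h) ^ 2 * eta_prod) $ (2 * h)
      \<in> int_multiples (int p ^ 2)"
    using fps_cong_nth [OF eta_prod_cong, of "2 * h"] residue
    by (simp only: G_def v_def) (simp add: p_eq)
  ultimately show ?thesis
    using int_multiples_add by fastforce
qed

lemma binom_term_convolution_cong:
  "[256 ^ h * binom_term_convolution h = int (central_binomial h) ^ 2 * eta12_coeff p]
    (mod int p ^ 2)"
proof -
  have "eta_prod $ (2 * h) = of_int (eta12_coeff p)"
    using eta12_coeff_eq_eta_prod_nth [of p] by (simp add: p_eq)
  then have "(of_nat (central_binomial h) ^ 2 * eta_prod) $ (2 * h)
      = of_int (int (central_binomial h) ^ 2 * eta12_coeff p)"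
    by (simp only: of_nat_power [symmetric] fps_mult_of_nat_nth) simp
  then have "rat_of_int
      (256 ^ h * binom_term_convolution h - int (central_binomial h) ^ 2 * eta12_coeff p)
      \<in> int_multiples (int p ^ 2)"
    using legendre_product_nth_cong by (simp only: legendre_fps_product_nth of_int_diff)
  then show ?thesis
    by (simp only: of_int_in_int_multiples_iff cong_iff_dvd_diff)
qed

end

theorem theorem5p1:
  fixes p :: nat
  assumes "prime p" and "odd p"
  shows "[eta12_coeff p =
           (\<Sum>k1\<le>(p-1) div 2. \<Sum>k2\<le>(p-1) div 2. \<Sum>k3\<le>(p-1) div 2. \<Sum>k4\<le>(p-1) div 2.
              if k1 + k2 = k3 + k4 then
                binom_term ((p-1) div 2) k1 * binom_term ((p-1) div 2) k2 *
                binom_term ((p-1) div 2) k3 * binom_term ((p-1) div 2) k4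
              else 0)] (mod (int p)^2)"
proof -
  define h where "h = (p - 1) div 2"
  have p: "p = 2 * h + 1"
    using \<open>odd p\<close> by (auto simp: h_def elim!: oddE)
  have "[256 ^ h * eta12_coeff p = int (central_binomial h) ^ 2 * eta12_coeff p] (mod int p ^ 2)"
    by (rule cong_scalar_right [OF cong_sym [OF central_binomial_square_cong [OF \<open>prime p\<close> p]]])
  also have "[int (central_binomial h) ^ 2 * eta12_coeff p = 256 ^ h * binom_term_convolution h]
      (mod int p ^ 2)"
    by (rule cong_sym [OF binom_term_convolution_cong [OF \<open>prime p\<close> p]])
  finally have "[256 ^ h * eta12_coeff p = 256 ^ h * binom_term_convolution h] (mod int p ^ 2)" .
  moreover have "\<not> p dvd 256"
    using odd_prime_not_dvd_power_2 [OF assms, of 8] by simp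
  then have "coprime (int 256 ^ h) (int p ^ 2)"
    by (rule coprime_int_prime_power [OF \<open>prime p\<close>])
  ultimately have "[eta12_coeff p = binom_term_convolution h] (mod int p ^ 2)"
    by (simp only: of_nat_numeral cong_mult_lcancel)
  then show ?thesis
    unfolding binom_term_convolution_def h_def .
qed

end
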